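(* There is an absolute constant $c'>0$ with the following property. Let $n\ge3$, let an endpoint-local monotone rule run on the $n$-cycle $C_n$, and let the initial integer-valued load vector have an arbitrary distribution independent of the future marks. Then, for every integer $k\ge1$, $$\mathbb{E}\,\operatorname{Gap}(X^{[k]})\ge c'\min\{\sqrt n,\,(k/n)^{1/4}\}$$ and $$\mathbb{P}\bigl(\operatorname{Gap}(X^{[k]})\ge c'\min\{\sqrt n,\,(k/n)^{1/4}\}\bigr)\ge\tfrac18 .$$ One may take $c'=(16384\pi\sqrt3)^{-1}$.
   Context: For a finite simple graph $G=(V,E)$, load vectors (profiles) are elements $x\in\mathbb{Z}^V$, and $\operatorname{Gap}(x)=\max_{v}x_v-\min_v x_v$. An endpoint-local monotone rule on $G$ is given by, for each edge $e\in E$, a fixed orientation $(u,v)$ of $e$ and a nonincreasing function $p_e:\mathbb{Z}\to[0,1]$ (the functions may differ between edges; constant functions are allowed). At each allocation event a uniformly random edge $e$ of $G$ and a mark $U$ uniform on $(0,1)$ are drawn, independently of each other and of everything before; if $e$ has orientation $(u,v)$ and the current load vector is $x$, one ball is added to $u$ if $U\le p_e(x_u-x_v)$ and to $v$ otherwise. (This is the event-indexed version of the continuous-time process in which edges ring at independent rate-one Poisson times.) $X^{[k]}$ denotes the load vector after exactly $k$ allocation events. *)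

theory Defs
  imports "HOL-Probability.Probability"
begin

definition simple_graph :: "'v set \<Rightarrow> 'v set set \<Rightarrow> bool" where
  "simple_graph V E \<longleftrightarrow> finite V \<and> (\<forall>e\<in>E. e \<subseteq> V \<and> card e = 2)"

definition cycle_vertices :: "nat \<Rightarrow> nat set" where
  "cycle_vertices n = {..<n}"

definition cycle_edges :: "nat \<Rightarrow> nat set set" where
  "cycle_edges n = {{i, Suc i mod n} | i. i < n}"

lemma simple_graph_cycle:
  assumes "n \<ge> 3"
  shows "simple_graph (cycle_vertices n) (cycle_edges n)"
proof -
  have "i \<noteq> Suc i mod n" if "i < n" for i
    using that assms by (cases "Suc i = n") auto
  then show ?thesis
    using assms by (auto simp: simple_graph_def cycle_vertices_def cycle_edges_def card_2_iff)
qed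

lemma card_cycle_edges:
  assumes "n \<ge> 3"
  shows "card (cycle_edges n) = n"
proof -
  have "inj_on (\<lambda>i. {i, Suc i mod n}) {..<n}"
  proof (rule inj_onI)
    fix i j assume ij: "i \<in> {..<n}" "j \<in> {..<n}" "{i, Suc i mod n} = {j, Suc j mod n}"
    show "i = j"
      using ij assms by (cases "Suc i = n"; cases "Suc j = n") (auto simp: doubleton_eq_iff)
  qed
  moreover have "cycle_edges n = (\<lambda>i. {i, Suc i mod n}) ` {..<n}"
    by (auto simp: cycle_edges_def)
  ultimately show ?thesis by (simp add: card_image)
qed

definition Gap :: "'v set \<Rightarrow> ('v \<Rightarrow> int) \<Rightarrow> int" where
  "Gap V x = Max (x ` V) - Min (x ` V)"

text \<open>The orientation of an edge \<open>e\<close> is the ordered pair \<open>ori e\<close> of its endpoints.\<close>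

definition endpoint_local_monotone_rule ::
    "'v set set \<Rightarrow> ('v set \<Rightarrow> 'v \<times> 'v) \<Rightarrow> ('v set \<Rightarrow> int \<Rightarrow> real) \<Rightarrow> bool" where
  "endpoint_local_monotone_rule E ori p \<longleftrightarrow>
     (\<forall>e\<in>E. e = {fst (ori e), snd (ori e)} \<and> antimono (p e) \<and> range (p e) \<subseteq> {0..1})"

definition allocate ::
    "('v set \<Rightarrow> 'v \<times> 'v) \<Rightarrow> ('v set \<Rightarrow> int \<Rightarrow> real) \<Rightarrow> 'v set \<Rightarrow> real \<Rightarrow> ('v \<Rightarrow> int) \<Rightarrow> ('v \<Rightarrow> int)" where
  "allocate ori p e r x =
     (let (u, v) = ori e;
          w = (if r \<le> p e (x u - x v) then u else v)
      in x(w := x w + 1))"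

text \<open>\<open>profile ori p X0 edge mark k \<omega>\<close> is the load vector after exactly \<open>k\<close> allocation events;
  the events are numbered from 0.\<close>

primrec profile ::
    "('v set \<Rightarrow> 'v \<times> 'v) \<Rightarrow> ('v set \<Rightarrow> int \<Rightarrow> real) \<Rightarrow> ('a \<Rightarrow> 'v \<Rightarrow> int) \<Rightarrow>
     (nat \<Rightarrow> 'a \<Rightarrow> 'v set) \<Rightarrow> (nat \<Rightarrow> 'a \<Rightarrow> real) \<Rightarrow> nat \<Rightarrow> 'a \<Rightarrow> 'v \<Rightarrow> int" where
  "profile ori p X0 edge mark 0 \<omega> = X0 \<omega>"
| "profile ori p X0 edge mark (Suc k) \<omega> =
     allocate ori p (edge k \<omega>) (mark k \<omega>) (profile ori p X0 edge mark k \<omega>)"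

abbreviation load_space :: "'v set \<Rightarrow> ('v \<Rightarrow> int) measure" where
  "load_space V \<equiv> (\<Pi>\<^sub>M v\<in>V. count_space UNIV)"

datatype source = Init | Edge nat | Mark nat

text \<open>The library's \<open>indep_vars\<close> needs all random variables to take values in one type; the
  assumption \<open>independent\<close> below is the same notion (mutual independence of the generated
  sigma-algebras) for the initial load vector, the edges and the marks taken together.\<close>

locale allocation_process = prob_space M
  for M :: "'a measure" +
  fixes V :: "'v set" and E :: "'v set set"
    and ori :: "'v set \<Rightarrow> 'v \<times> 'v" and p :: "'v set \<Rightarrow> int \<Rightarrow> real"
    and X0 :: "'a \<Rightarrow> 'v \<Rightarrow> int"
    and edge :: "nat \<Rightarrow> 'a \<Rightarrow> 'v set" and mark :: "nat \<Rightarrow> 'a \<Rightarrow> real"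
  assumes graph: "simple_graph V E"
    and rule: "endpoint_local_monotone_rule E ori p"
    and initial: "X0 \<in> measurable M (load_space V)"
    and edge_measurable: "\<And>j. edge j \<in> measurable M (count_space E)"
    and edge_uniform: "\<And>j. distr M (count_space E) (edge j) = uniform_count_measure E"
    and mark_measurable: "\<And>j. mark j \<in> borel_measurable M"
    and mark_uniform: "\<And>j. distr M lborel (mark j) = uniform_measure lborel {0<..<1}"
    and independent: "indep_sets
          (\<lambda>s. case s of
             Init \<Rightarrow> {X0 -` A \<inter> space M | A. A \<in> sets (load_space V)}
           | Edge j \<Rightarrow> {edge j -` A \<inter> space M | A. A \<in> sets (count_space E)}
           | Mark j \<Rightarrow> {mark j -` A \<inter> space M | A. A \<in> sets borel}) UNIV"

end

theory Submission
  imports Defs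
begin

text \<open>Let \<open>B\<^sub>i\<close> be the Markov operator of an allocation along the edge \<open>i\<close> of the cycle, \<open>L\<close> the average
of the \<open>B\<^sub>i\<close>, and \<open>\<phi>\<close> a weight on the cycle (a positive and a negative tent of height \<open>h\<close>) with
sum zero. Take \<open>Z = \<Sum>\<^sub>v \<phi>\<^sub>v x\<^sub>v\<close>, which is at most a constant times \<open>h\<^sup>2 Gap(x)\<close>, cut it off to a bounded
observable \<open>f\<close>, and correlate \<open>f(X\<^sub>k)\<close> with the martingale \<open>\<Sum>\<^sub>s \<phi>(e\<^sub>s)\<close> over the last \<open>n t\<close> events.
The correlation with \<open>\<phi>(e\<^sub>s)\<close> involves \<open>(\<Sum>\<^sub>i \<phi>\<^sub>i B\<^sub>i) L\<^sup>r f\<close>. Moving the weighted operator to the right of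
\<open>L\<^sup>r\<close> costs commutators of adjacent edges only; monotonicity of the rule makes their sum
telescope, so the cost is at most \<open>2 r / n\<close> times the total variation of \<open>\<phi>\<close>. If the gap were small with high
probability, the correlation would therefore be about \<open>t \<Sum>\<^sub>i \<phi>\<^sub>i\<^sup>2\<close>, of order \<open>h\<^sup>5\<close> for \<open>t\<close> of order \<open>h\<^sup>2\<close>,
whereas the inequality of the means bounds it by the second moments of \<open>f\<close> and of the martingale.\<close>

section \<open>Allocation operators on the cycle\<close>

definition add_ball :: "'v \<Rightarrow> ('v \<Rightarrow> int) \<Rightarrow> 'v \<Rightarrow> int" where
  "add_ball v x = x(v := x v + 1)"

lemma add_ball_commute: "add_ball u (add_ball v x) = add_ball v (add_ball u x)"
  by (auto simp: add_ball_def fun_eq_iff)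

lemma add_ball_apply: "add_ball v x u = x u + (if u = v then 1 else 0)"
  by (auto simp: add_ball_def)

text \<open>Every edge is read clockwise here: \<open>q i d\<close> is the probability that edge
  \<open>i\<close> serves its left end \<open>i\<close> when the load there exceeds the load at the
  other end by \<open>d\<close>. Arbitrary orientations are brought to this form by
  \<open>left_prob\<close>.\<close>

locale cycle_dynamics =
  fixes n :: nat and q :: "nat \<Rightarrow> int \<Rightarrow> real"
  assumes n3: "n \<ge> 3"
    and antimono_q: "i < n \<Longrightarrow> d \<le> d' \<Longrightarrow> q i d' \<le> q i d"
    and q_nonneg: "i < n \<Longrightarrow> 0 \<le> q i d"
    and q_le_1: "i < n \<Longrightarrow> q i d \<le> 1"
begin

section \<open>The cyclic successor\<close>

definition nx :: "nat \<Rightarrow> nat" where "nx i = Suc i mod n"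

lemma nx_less [simp]: "nx i < n"
  using n3 by (simp add: nx_def)

lemma nx_eq: "i < n \<Longrightarrow> nx i = (if Suc i = n then 0 else Suc i)"
  by (auto simp: nx_def)

lemma nx_inj [simp]: "i < n \<Longrightarrow> j < n \<Longrightarrow> nx i = nx j \<longleftrightarrow> i = j"
  by (auto simp: nx_eq split: if_splits)

lemma nx_neq [simp]: "i < n \<Longrightarrow> nx i \<noteq> i" "i < n \<Longrightarrow> i \<noteq> nx i"
  using n3 by (auto simp: nx_eq split: if_splits)

lemma nx_nx_neq [simp]: "i < n \<Longrightarrow> nx (nx i) \<noteq> i" "i < n \<Longrightarrow> i \<noteq> nx (nx i)"
  using n3 by (auto simp: nx_eq split: if_splits)

lemma bij_nx: "bij_betw nx {..<n} {..<n}"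
proof -
  have "inj_on nx {..<n}" by (auto simp: inj_on_def)
  moreover have "nx ` {..<n} \<subseteq> {..<n}" by auto
  ultimately show ?thesis
    by (simp add: bij_betw_def endo_inj_surj)
qed

lemma sum_nx: "(\<Sum>i<n. F (nx i)) = (\<Sum>i<n. F i)"
  using sum.reindex_bij_betw[OF bij_nx] .

text \<open>\<open>ev i\<close>, \<open>step\<close> and \<open>wev \<phi>\<close> are the operator
  of edge \<open>i\<close>, the average \<open>L\<close> and the weighted sum, the last one without
  the factor \<open>1 / n\<close>.\<close>

definition ev :: "nat \<Rightarrow> ((nat \<Rightarrow> int) \<Rightarrow> real) \<Rightarrow> (nat \<Rightarrow> int) \<Rightarrow> real" where
  "ev i g x = q i (x i - x (nx i)) * g (add_ball i x)
     + (1 - q i (x i - x (nx i))) * g (add_ball (nx i) x)"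

definition step :: "((nat \<Rightarrow> int) \<Rightarrow> real) \<Rightarrow> (nat \<Rightarrow> int) \<Rightarrow> real" where
  "step g x = (\<Sum>i<n. ev i g x) / n"

definition wev :: "(nat \<Rightarrow> real) \<Rightarrow> ((nat \<Rightarrow> int) \<Rightarrow> real) \<Rightarrow> (nat \<Rightarrow> int) \<Rightarrow> real" where
  "wev \<phi> g x = (\<Sum>i<n. \<phi> i * ev i g x)"

text \<open>Replacing \<open>add_ball (nx j) x\<close> by \<open>add_ball j x\<close> raises by one the number of balls that edge \<open>j\<close>
  has sent to its left end. The condition says that \<open>R\<close>, plus \<open>w j\<close> for each such ball, is nondecreasing
  in these numbers; the dynamics lifted to the numbers is attractive and preserves monotonicity.\<close>

definition current_mono :: "(nat \<Rightarrow> real) \<Rightarrow> ((nat \<Rightarrow> int) \<Rightarrow> real) \<Rightarrow> bool" where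
  "current_mono w R \<longleftrightarrow> (\<forall>x. \<forall>j<n. R (add_ball (nx j) x) \<le> R (add_ball j x) + w j)"

lemma convex_le:
  fixes t :: real
  assumes "0 \<le> t" "t \<le> 1" "a \<le> c" "b \<le> c"
  shows "t * a + (1 - t) * b \<le> c"
  using assms convex_bound_le[of a c b t "1 - t"] by simp

lemma convex_ge:
  fixes t :: real
  assumes "0 \<le> t" "t \<le> 1" "c \<le> a" "c \<le> b"
  shows "c \<le> t * a + (1 - t) * b"
  using convex_le[of t "-a" "-c" "-b"] assms by simp

text \<open>The added term is the expected contribution of a left move of edge \<open>i\<close>. For
  \<open>j = i\<close> the two starting states reach a common state; for \<open>j \<noteq> i\<close>
  they are coupled, and monotonicity of the rule makes a left move of \<open>i\<close> at least as
  likely from the state where \<open>j\<close> has moved left.\<close>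

lemma current_mono_ev:
  assumes R: "current_mono w R" and i: "i < n"
  shows "current_mono w (\<lambda>x. ev i R x + w i * q i (x i - x (nx i)))"
  unfolding current_mono_def
proof (intro allI impI)
  fix x j assume j: "j < n"
  have Rm: "R (add_ball (nx k) y) \<le> R (add_ball k y) + w k" if "k < n" for k y
    using R that by (auto simp: current_mono_def)
  define y where "y = add_ball (nx j) x"
  define y' where "y' = add_ball j x"
  define a where "a = q i (y i - y (nx i))"
  define a' where "a' = q i (y' i - y' (nx i))"
  have a: "0 \<le> a" "a \<le> 1" and a': "0 \<le> a'" "a' \<le> 1"
    using q_nonneg q_le_1 i by (auto simp: a_def a'_def)
  have L: "ev i R y + w i * a = a * (R (add_ball i y) + w i) + (1 - a) * R (add_ball (nx i) y)"
    by (simp add: ev_def a_def algebra_simps)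
  have L': "ev i R y' + w i * a' = a' * (R (add_ball i y') + w i) + (1 - a') * R (add_ball (nx i) y')"
    by (simp add: ev_def a'_def algebra_simps)
  have "ev i R y + w i * a \<le> ev i R y' + w i * a' + w j"
  proof (cases "j = i")
    case True
    \<comment> \<open>One right and one left move of edge \<open>i\<close>, in either order, lead to
      the value \<open>m\<close>; both averages are compared with it.\<close>
    define m where "m = R (add_ball i (add_ball (nx i) x))"
    have m1: "R (add_ball i y) = m" and m2: "R (add_ball (nx i) y') = m"
      by (simp_all add: y_def y'_def m_def True add_ball_commute)
    have l: "R (add_ball (nx i) y) \<le> m + w i" using Rm[OF i, of y] by (simp add: m1)
    have r: "m \<le> R (add_ball i y') + w i" using Rm[OF i, of y'] by (simp add: m2)
    have "ev i R y + w i * a \<le> m + w i" unfolding L m1 by (rule convex_le) (use a l in auto)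
    moreover have "m \<le> ev i R y' + w i * a'" unfolding L' m2 by (rule convex_ge) (use a' r in auto)
    ultimately show ?thesis using True by simp
  next
    case False
    \<comment> \<open>A ball on \<open>j\<close> instead of \<open>nx j\<close> either takes a ball
      from the left end of edge \<open>i\<close>, adds one to its right end, or leaves the load
      difference unchanged.\<close>
    have "y' i - y' (nx i) \<le> y i - y (nx i)"
      using False i j by (auto simp: y_def y'_def add_ball_apply)
    then have aa: "a \<le> a'" unfolding a_def a'_def using antimono_q[OF i] by blast
    have 1: "R (add_ball i y) \<le> R (add_ball i y') + w j"
      using Rm[OF j, of "add_ball i x"] by (simp add: y_def y'_def add_ball_commute)
    have 2: "R (add_ball (nx i) y) \<le> R (add_ball (nx i) y') + w j"
      using Rm[OF j, of "add_ball (nx i) x"] by (simp add: y_def y'_def add_ball_commute)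
    have 3: "R (add_ball (nx i) y') \<le> R (add_ball i y') + w i" using Rm[OF i] .
    have "a * (R (add_ball i y) + w i) \<le> a * (R (add_ball i y') + w j + w i)"
      using 1 a by (intro mult_left_mono) auto
    moreover have "(1 - a) * R (add_ball (nx i) y) \<le> (1 - a) * (R (add_ball (nx i) y') + w j)"
      using 2 a by (intro mult_left_mono) auto
    \<comment> \<open>The extra mass \<open>a' - a\<close> moves left only from \<open>y'\<close>;
      the term with \<open>w i\<close> pays for what \<open>R\<close> may lose by this.\<close>
    moreover have "(a' - a) * (R (add_ball i y') + w i - R (add_ball (nx i) y')) \<ge> 0"
      using 3 aa by auto
    ultimately show ?thesis unfolding L L' by (simp add: algebra_simps)
  qed
  then show "ev i R (add_ball (nx j) x) + w i * q i (add_ball (nx j) x i - add_ball (nx j) x (nx i))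
    \<le> ev i R (add_ball j x) + w i * q i (add_ball j x i - add_ball j x (nx i)) + w j"
    unfolding a_def a'_def y_def y'_def .
qed

lemma current_mono_step:
  assumes R: "current_mono w R"
  shows "current_mono w (\<lambda>x. step R x + (\<Sum>i<n. w i * q i (x i - x (nx i))) / n)"
  unfolding current_mono_def
proof (intro allI impI)
  fix x j assume j: "j < n"
  define F where "F i y = ev i R y + w i * q i (y i - y (nx i))" for i y
  have "F i (add_ball (nx j) x) \<le> F i (add_ball j x) + w j" if "i < n" for i
    using current_mono_ev[OF R that] j unfolding current_mono_def F_def by blast
  then have "(\<Sum>i<n. F i (add_ball (nx j) x)) \<le> (\<Sum>i<n. F i (add_ball j x) + w j)"
    by (intro sum_mono) auto
  also have "\<dots> = (\<Sum>i<n. F i (add_ball j x)) + n * w j" by (simp add: sum.distrib)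
  finally have "(\<Sum>i<n. F i (add_ball (nx j) x)) / n \<le> ((\<Sum>i<n. F i (add_ball j x)) + n * w j) / n"
    by (rule divide_right_mono) simp
  moreover have "step R y + (\<Sum>i<n. w i * q i (y i - y (nx i))) / n = (\<Sum>i<n. F i y) / n" for y
    by (simp add: step_def F_def sum.distrib add_divide_distrib)
  ultimately show "step R (add_ball (nx j) x)
      + (\<Sum>i<n. w i * q i (add_ball (nx j) x i - add_ball (nx j) x (nx i))) / n
    \<le> step R (add_ball j x) + (\<Sum>i<n. w i * q i (add_ball j x i - add_ball j x (nx i))) / n + w j"
    using n3 by (simp add: add_divide_distrib)
qed

section \<open>Linearity and contraction of the operators\<close>

lemma ev_add: "ev i (\<lambda>x. g x + h x) x = ev i g x + ev i h x"
  by (simp add: ev_def algebra_simps)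

lemma ev_diff: "ev i (\<lambda>x. g x - h x) x = ev i g x - ev i h x"
  by (simp add: ev_def algebra_simps)

lemma ev_sum: "finite A \<Longrightarrow> ev i (\<lambda>x. \<Sum>a\<in>A. c a * g a x) x = (\<Sum>a\<in>A. c a * ev i (g a) x)"
  by (simp add: ev_def algebra_simps sum_distrib_left sum.distrib sum_subtractf)

lemma step_add: "step (\<lambda>x. g x + h x) x = step g x + step h x"
  by (simp add: step_def ev_add sum.distrib add_divide_distrib)

lemma step_diff: "step (\<lambda>x. g x - h x) x = step g x - step h x"
  by (simp add: step_def ev_diff sum_subtractf diff_divide_distrib)

lemma ev_abs_le:
  assumes "i < n" "\<And>y. \<bar>g y\<bar> \<le> C"
  shows "\<bar>ev i g x\<bar> \<le> C"
proof -
  have g: "g y \<le> C" "- C \<le> g y" for y using assms(2)[of y] by auto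
  have "ev i g x \<le> C" unfolding ev_def
    using assms(1) g by (intro convex_le q_nonneg q_le_1)
  moreover have "- C \<le> ev i g x" unfolding ev_def
    using assms(1) g by (intro convex_ge q_nonneg q_le_1)
  ultimately show ?thesis by simp
qed

lemma step_abs_le:
  assumes "\<And>y. \<bar>g y\<bar> \<le> C"
  shows "\<bar>step g x\<bar> \<le> C"
proof -
  have "\<bar>\<Sum>i<n. ev i g x\<bar> \<le> (\<Sum>i<n. C)"
    by (rule order_trans[OF sum_abs sum_mono]) (use ev_abs_le[of _ g C] assms in auto)
  then show ?thesis using n3 by (simp add: step_def field_simps)
qed

lemma step_pow_abs_le: "(\<And>y. \<bar>g y\<bar> \<le> C) \<Longrightarrow> \<bar>(step ^^ r) g x\<bar> \<le> C"
  by (induction r arbitrary: x) (auto intro!: step_abs_le)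

text \<open>The function \<open>\<Gamma>\<close> is the expected weighted number of leftward moves during the \<open>r\<close> events.\<close>

lemma current_mono_step_pow:
  assumes "\<And>x j. j < n \<Longrightarrow> \<bar>f (add_ball (nx j) x) - f (add_ball j x)\<bar> \<le> w j"
  shows "\<exists>\<Gamma>. current_mono w (\<lambda>x. \<Gamma> x + (step ^^ r) f x) \<and> current_mono w (\<lambda>x. \<Gamma> x - (step ^^ r) f x)"
proof (induction r)
  case 0
  have "current_mono w f" "current_mono w (\<lambda>x. - f x)"
    using assms unfolding current_mono_def by (smt (verit))+
  then show ?case by (intro exI[of _ "\<lambda>_. 0"]) simp
next
  case (Suc r)
  then obtain \<Gamma> where G: "current_mono w (\<lambda>x. \<Gamma> x + (step ^^ r) f x)"
    "current_mono w (\<lambda>x. \<Gamma> x - (step ^^ r) f x)" by blast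
  \<comment> \<open>The new term depends on \<open>w\<close> and the rule, not on the observable, so
    one \<open>\<Gamma>\<close> serves both signs.\<close>
  show ?case
    using G[THEN current_mono_step]
    by (intro exI[of _ "\<lambda>x. step \<Gamma> x + (\<Sum>i<n. w i * q i (x i - x (nx i))) / n"])
      (simp add: step_add step_diff algebra_simps)
qed

section \<open>Commutators of edge operators\<close>

definition comm :: "nat \<Rightarrow> nat \<Rightarrow> ((nat \<Rightarrow> int) \<Rightarrow> real) \<Rightarrow> (nat \<Rightarrow> int) \<Rightarrow> real" where
  "comm i j g x = ev i (ev j g) x - ev j (ev i g) x"

lemma comm_swap: "comm i j g x = - comm j i g x"
  by (simp add: comm_def)

text \<open>The two edges coincide or are disjoint; disjoint edges do not change each other's load
  difference.\<close>

lemma comm_far: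
  assumes "i < n" "j < n" "j \<noteq> nx i" "i \<noteq> nx j"
  shows "comm i j g x = 0"
proof (cases "i = j")
  case False
  then have "nx i \<noteq> nx j" using assms by simp
  then show ?thesis using assms False
    by (simp add: comm_def ev_def add_ball_apply add_ball_commute algebra_simps)
qed (simp add: comm_def)

text \<open>The order of the two events matters only through the shared vertex \<open>nx i\<close>:
  a ball put there by one edge changes the left probability of the other, in a direction fixed by
  monotonicity. The coefficients \<open>s\<close> and \<open>t\<close> depend on the state but not
  on \<open>g\<close>.\<close>

lemma comm_adjacent:
  assumes i: "i < n"
  obtains s t where "0 \<le> s" "s \<le> 1" "0 \<le> t" "t \<le> 1"
    "\<And>g. comm i (nx i) g x =
      - s * (g (add_ball i (add_ball (nx i) x)) - g (add_ball (nx i) (add_ball (nx i) x)))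
      - t * (g (add_ball (nx i) (add_ball (nx i) x)) - g (add_ball (nx (nx i)) (add_ball (nx i) x)))"
proof -
  define d where "d = x i - x (nx i)"
  define d' where "d' = x (nx i) - x (nx (nx i))"
  define a where "a = q i d"
  \<comment> \<open>\<open>a'\<close> and, below, \<open>b'\<close> are the left probabilities after
    the other edge has put a ball on \<open>nx i\<close>.\<close>
  define a' where "a' = q i (d - 1)"
  define b where "b = q (nx i) d'"
  define b' where "b' = q (nx i) (d' + 1)"
  have ab: "0 \<le> a" "a \<le> a'" "a' \<le> 1" "0 \<le> b'" "b' \<le> b" "b \<le> 1"
    using i by (auto simp: a_def a'_def b_def b'_def intro!: q_nonneg q_le_1 antimono_q)
  show ?thesis
  proof (rule that[of "b * (a' - a)" "(1 - a) * (b - b')"])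
    show "0 \<le> b * (a' - a)" "0 \<le> (1 - a) * (b - b')" using ab by auto
    show "b * (a' - a) \<le> 1" "(1 - a) * (b - b') \<le> 1" using ab by (auto intro!: mult_le_one)
    fix g :: "(nat \<Rightarrow> int) \<Rightarrow> real"
    \<comment> \<open>The two digits tell whether edge \<open>i\<close> and edge \<open>nx i\<close>
      move left. The coefficient of \<open>g10\<close> is \<open>a * (1 - b)\<close> in both orders
      and cancels.\<close>
    define g11 where "g11 = g (add_ball i (add_ball (nx i) x))"
    define g01 where "g01 = g (add_ball (nx i) (add_ball (nx i) x))"
    define g00 where "g00 = g (add_ball (nx (nx i)) (add_ball (nx i) x))"
    define g10 where "g10 = g (add_ball i (add_ball (nx (nx i)) x))"
    have n: "nx i < n" "i \<noteq> nx i" "nx i \<noteq> nx (nx i)" "i \<noteq> nx (nx i)" using i by auto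
    have c: "d - 1 = x i - (x (nx i) + 1)" "d' + 1 = x (nx i) + 1 - x (nx (nx i))"
      by (simp_all add: d_def d'_def)
    have co: "add_ball (nx i) (add_ball i x) = add_ball i (add_ball (nx i) x)"
      "add_ball (nx (nx i)) (add_ball i x) = add_ball i (add_ball (nx (nx i)) x)"
      "add_ball (nx i) (add_ball (nx (nx i)) x) = add_ball (nx (nx i)) (add_ball (nx i) x)"
      by (rule add_ball_commute)+
    have e1: "ev i (ev (nx i) g) x = a * (b * g11 + (1 - b) * g10) + (1 - a) * (b' * g01 + (1 - b') * g00)"
      unfolding ev_def a_def b_def b'_def c g11_def g01_def g00_def g10_def unfolding d_def d'_def
      using n n(2-4)[symmetric]
      by (simp add: add_ball_apply co)
    have e2: "ev (nx i) (ev i g) x = b * (a' * g11 + (1 - a') * g01) + (1 - b) * (a * g10 + (1 - a) * g00)"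
      unfolding ev_def a_def b_def a'_def c g11_def g01_def g00_def g10_def unfolding d_def d'_def
      using n n(2-4)[symmetric]
      by (simp add: add_ball_apply co)
    show "comm i (nx i) g x = - (b * (a' - a)) * (g11 - g01) - ((1 - a) * (b - b')) * (g01 - g00)"
      unfolding comm_def e1 e2 by (simp add: algebra_simps)
  qed
qed

text \<open>The hypotheses bound a discrete gradient of \<open>g\<close> by \<open>w\<close> plus the gradient of \<open>\<Gamma>\<close>; in the
  commutator of \<open>i\<close> and \<open>nx i\<close> the latter is \<open>u i - u (nx i)\<close> with
  \<open>u i = \<Gamma> (add_ball i (add_ball (nx i) x))\<close>, which telescopes around the cycle.\<close>

lemma sum_comm_le:
  assumes "current_mono w (\<lambda>x. \<Gamma> x + g x)" "current_mono w (\<lambda>x. \<Gamma> x - g x)"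
  shows "(\<Sum>i<n. \<bar>comm i (nx i) g x\<bar>) \<le> 2 * (\<Sum>i<n. w i)"
proof -
  have D: "\<bar>g (add_ball j y) - g (add_ball (nx j) y)\<bar> \<le> w j + \<Gamma> (add_ball j y) - \<Gamma> (add_ball (nx j) y)"
    if "j < n" for j y
    using assms that unfolding current_mono_def by (smt (verit))
  \<comment> \<open>The values of \<open>\<Gamma>\<close> at
    \<open>add_ball (nx i) (add_ball (nx i) x)\<close> cancel when the two gradient bounds are
    added.\<close>
  have "\<bar>comm i (nx i) g x\<bar> \<le> w i + w (nx i) + \<Gamma> (add_ball i (add_ball (nx i) x))
      - \<Gamma> (add_ball (nx i) (add_ball (nx (nx i)) x))" if i: "i < n" for i
  proof -
    obtain s t where st: "0 \<le> s" "s \<le> 1" "0 \<le> t" "t \<le> 1"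
      and c: "comm i (nx i) g x =
      - s * (g (add_ball i (add_ball (nx i) x)) - g (add_ball (nx i) (add_ball (nx i) x)))
      - t * (g (add_ball (nx i) (add_ball (nx i) x)) - g (add_ball (nx (nx i)) (add_ball (nx i) x)))"
      using comm_adjacent[OF i] by metis
    have "\<bar>s * u + t * v\<bar> \<le> \<bar>u\<bar> + \<bar>v\<bar>" for u v :: real
    proof -
      have "\<bar>s * u + t * v\<bar> \<le> s * \<bar>u\<bar> + t * \<bar>v\<bar>"
        using st abs_triangle_ineq[of "s * u" "t * v"] by (simp add: abs_mult)
      also have "\<dots> \<le> 1 * \<bar>u\<bar> + 1 * \<bar>v\<bar>" using st by (intro add_mono mult_right_mono) auto
      finally show ?thesis by simp
    qed
    from this[of "g (add_ball i (add_ball (nx i) x)) - g (add_ball (nx i) (add_ball (nx i) x))"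
       "g (add_ball (nx i) (add_ball (nx i) x)) - g (add_ball (nx (nx i)) (add_ball (nx i) x))"]
    show ?thesis unfolding c using D[OF i, of "add_ball (nx i) x"] D[of "nx i" "add_ball (nx i) x"]
      by (simp add: add_ball_commute[of "nx (nx i)" "nx i"])
  qed
  then have "(\<Sum>i<n. \<bar>comm i (nx i) g x\<bar>) \<le> (\<Sum>i<n. w i + w (nx i)
      + \<Gamma> (add_ball i (add_ball (nx i) x)) - \<Gamma> (add_ball (nx i) (add_ball (nx (nx i)) x)))"
    by (intro sum_mono) auto
  also have "\<dots> = 2 * (\<Sum>i<n. w i)"
    using sum_nx[of w] sum_nx[of "\<lambda>i. \<Gamma> (add_ball i (add_ball (nx i) x))"]
    by (simp add: sum.distrib sum_subtractf)
  finally show ?thesis .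
qed

text \<open>Only adjacent pairs contribute, and antisymmetry of the commutator turns the two weights
  of such a pair into their difference.\<close>

lemma step_wev_commutator:
  "step (wev \<phi> g) x - wev \<phi> (step g) x = (\<Sum>i<n. (\<phi> (nx i) - \<phi> i) * comm i (nx i) g x) / n"
proof -
  define c where "c i j = \<phi> j * comm i j g x" for i j
  \<comment> \<open>The two conditions exclude each other since \<open>n \<ge> 3\<close>, so no pair
    is counted twice.\<close>
  have c: "c i j = (if j = nx i then c i j else 0) + (if i = nx j then c i j else 0)"
    if "i < n" "j < n" for i j
    using that comm_far[of i j g x] by (auto simp: c_def)
  have 1: "step (wev \<phi> g) x = (\<Sum>i<n. \<Sum>j<n. \<phi> j * ev i (ev j g) x) / n"
    unfolding step_def wev_def by (simp add: ev_sum)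
  have "ev i (step g) x = (\<Sum>j<n. ev i (ev j g) x) / n" for i
    using ev_sum[of "{..<n}" i "\<lambda>_. 1 / real n" "\<lambda>j. ev j g" x]
    by (simp add: step_def[abs_def] sum_divide_distrib)
  then have "wev \<phi> (step g) x = (\<Sum>j<n. \<Sum>i<n. \<phi> j * ev j (ev i g) x) / n"
    by (simp add: wev_def sum_distrib_left sum_divide_distrib)
  also have "(\<Sum>j<n. \<Sum>i<n. \<phi> j * ev j (ev i g) x) = (\<Sum>i<n. \<Sum>j<n. \<phi> j * ev j (ev i g) x)"
    by (rule sum.swap)
  finally have "step (wev \<phi> g) x - wev \<phi> (step g) x = (\<Sum>i<n. \<Sum>j<n. c i j) / n"
    unfolding 1 by (simp add: c_def comm_def diff_divide_distrib[symmetric] sum_subtractf[symmetric] algebra_simps)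
  also have "(\<Sum>i<n. \<Sum>j<n. c i j)
      = (\<Sum>i<n. \<Sum>j<n. (if j = nx i then c i j else 0) + (if i = nx j then c i j else 0))"
    using c by (intro sum.cong refl) auto
  also have "\<dots> = (\<Sum>i<n. \<Sum>j<n. if j = nx i then c i j else 0) + (\<Sum>i<n. \<Sum>j<n. if i = nx j then c i j else 0)"
    by (simp add: sum.distrib)
  also have "(\<Sum>i<n. \<Sum>j<n. if i = nx j then c i j else 0) = (\<Sum>j<n. \<Sum>i<n. if i = nx j then c i j else 0)"
    by (rule sum.swap)
  also have "(\<Sum>i<n. \<Sum>j<n. if j = nx i then c i j else 0) + (\<Sum>j<n. \<Sum>i<n. if i = nx j then c i j else 0)
    = (\<Sum>i<n. c i (nx i)) + (\<Sum>i<n. c (nx i) i)" by simp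
  also have "\<dots> = (\<Sum>i<n. (\<phi> (nx i) - \<phi> i) * comm i (nx i) g x)"
    unfolding sum.distrib[symmetric] c_def
    by (intro sum.cong refl) (subst comm_swap[of "nx _"], simp add: algebra_simps)
  finally show ?thesis .
qed

text \<open>The factors \<open>step\<close> are moved across one at a time. Each exchange costs at
  most \<open>2 * (\<Sum>i<n. w i) / n\<close>, with the same \<open>w\<close> for every power, and
  applying \<open>step\<close> does not increase the errors made before.\<close>

lemma step_pow_wev_commutator_le:
  assumes f: "\<And>x j. j < n \<Longrightarrow> \<bar>f (add_ball (nx j) x) - f (add_ball j x)\<bar> \<le> w j"
    and slope: "\<And>i. i < n \<Longrightarrow> \<bar>\<phi> (nx i) - \<phi> i\<bar> \<le> 1"
  shows "\<bar>(step ^^ r) (wev \<phi> f) x - wev \<phi> ((step ^^ r) f) x\<bar> \<le> r * (2 * (\<Sum>i<n. w i) / n)"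
proof (induction r arbitrary: x)
  case (Suc r)
  let ?g = "(step ^^ r) f"
  obtain \<Gamma> where G: "current_mono w (\<lambda>x. \<Gamma> x + ?g x)" "current_mono w (\<lambda>x. \<Gamma> x - ?g x)"
    using current_mono_step_pow[OF f] by blast
  have "\<bar>\<Sum>i<n. (\<phi> (nx i) - \<phi> i) * comm i (nx i) ?g x\<bar> \<le> (\<Sum>i<n. \<bar>comm i (nx i) ?g x\<bar>)"
    using slope by (intro order_trans[OF sum_abs sum_mono]) (auto simp: abs_mult intro: mult_left_le_one_le)
  also have "\<dots> \<le> 2 * (\<Sum>i<n. w i)" using sum_comm_le[OF G] .
  finally have 1: "\<bar>step (wev \<phi> ?g) x - wev \<phi> (step ?g) x\<bar> \<le> 2 * (\<Sum>i<n. w i) / n"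
    unfolding step_wev_commutator by (simp add: divide_right_mono)
  have 2: "\<bar>step (\<lambda>y. (step ^^ r) (wev \<phi> f) y - wev \<phi> ?g y) x\<bar> \<le> r * (2 * (\<Sum>i<n. w i) / n)"
    using Suc by (rule step_abs_le)
  show ?case using 1 2 unfolding step_diff by (simp add: algebra_simps add_divide_distrib)
qed simp

end

section \<open>One allocation event\<close>

text \<open>The product rule on rectangles identifies the joint law of \<open>W\<close> and
  \<open>F\<close> with the product of their laws, and Fubini applies. Later \<open>W\<close>
  carries the past and \<open>F\<close> the next edge and mark.\<close>

lemma (in prob_space) expectation_independent_pair:
  fixes h :: "_ \<Rightarrow> real"
  assumes W [measurable]: "random_variable S W" and F [measurable]: "random_variable T F"
    and ind: "\<And>A B. A \<in> sets S \<Longrightarrow> B \<in> sets T \<Longrightarrow>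
      prob ((W -` A \<inter> space M) \<inter> (F -` B \<inter> space M)) = prob (W -` A \<inter> space M) * prob (F -` B \<inter> space M)"
    and h: "h \<in> borel_measurable (S \<Otimes>\<^sub>M T)"
    and bound: "\<And>z. \<bar>h z\<bar> \<le> B"
  shows "expectation (\<lambda>\<omega>. h (W \<omega>, F \<omega>)) = expectation (\<lambda>\<omega>. expectation (\<lambda>\<omega>'. h (W \<omega>, F \<omega>')))"
proof -
  note [measurable] = h
  interpret W: prob_space "distr M S W" by (rule prob_space_distr) simp
  interpret F: prob_space "distr M T F" by (rule prob_space_distr) simp
  interpret WF: pair_prob_space "distr M S W" "distr M T F" ..
  have eq: "distr M S W \<Otimes>\<^sub>M distr M T F = distr M (S \<Otimes>\<^sub>M T) (\<lambda>x. (W x, F x))"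
  proof (rule pair_measure_eqI)
    fix A B assume "A \<in> sets (distr M S W)" "B \<in> sets (distr M T F)"
    then have AB: "A \<in> sets S" "B \<in> sets T" by auto
    have "(\<lambda>x. (W x, F x)) -` (A \<times> B) \<inter> space M = (W -` A \<inter> space M) \<inter> (F -` B \<inter> space M)" by auto
    then show "emeasure (distr M S W) A * emeasure (distr M T F) B
        = emeasure (distr M (S \<Otimes>\<^sub>M T) (\<lambda>x. (W x, F x))) (A \<times> B)"
      using AB ind[OF AB] by (simp add: emeasure_distr emeasure_eq_measure ennreal_mult)
  qed (simp_all add: W.sigma_finite_measure_axioms F.sigma_finite_measure_axioms cong: sets_pair_measure_cong)
  have int: "integrable (distr M S W \<Otimes>\<^sub>M distr M T F) h"
    by (rule WF.P.integrable_const_bound[where B=B]) (use bound h in simp_all)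
  have "expectation (\<lambda>\<omega>. h (W \<omega>, F \<omega>)) = (\<integral>z. h z \<partial>(distr M S W \<Otimes>\<^sub>M distr M T F))"
    unfolding eq by (rule integral_distr[symmetric]) (simp_all add: h)
  also have "\<dots> = (\<integral>w. (\<integral>v. h (w, v) \<partial>distr M T F) \<partial>distr M S W)"
    using WF.integral_fst'[OF int] by simp
  also have "\<dots> = expectation (\<lambda>\<omega>. (\<integral>v. h (W \<omega>, v) \<partial>distr M T F))"
    by (rule integral_distr[OF W]) (rule F.borel_measurable_lebesgue_integral, use h in simp)
  also have "\<dots> = expectation (\<lambda>\<omega>. expectation (\<lambda>\<omega>'. h (W \<omega>, F \<omega>')))"
  proof (rule Bochner_Integration.integral_cong[OF refl])
    fix \<omega> assume "\<omega> \<in> space M"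
    then have "W \<omega> \<in> space S" by (rule measurable_space[OF W])
    then show "(\<integral>v. h (W \<omega>, v) \<partial>distr M T F) = expectation (\<lambda>\<omega>'. h (W \<omega>, F \<omega>'))"
      by (intro integral_distr[OF F] measurable_compose[OF measurable_Pair1' h]) simp
  qed
  finally show ?thesis .
qed

lemma Int_stable_vimages: "Int_stable {f -` A \<inter> \<Omega> | A. A \<in> sets N}"
  unfolding Int_stable_def
proof safe
  fix A B assume "A \<in> sets N" "B \<in> sets N"
  then show "\<exists>C. (f -` A \<inter> \<Omega>) \<inter> (f -` B \<inter> \<Omega>) = f -` C \<inter> \<Omega> \<and> C \<in> sets N"
    by (intro exI[of _ "A \<inter> B"]) auto
qed

lemma load_space_eq_count_space:
  assumes "finite V"
  shows "load_space V = count_space (PiE V (\<lambda>_. UNIV))"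
  using count_space_PiM_finite[OF assms, of "\<lambda>_. UNIV :: int set"] by simp

context allocation_process
begin

section \<open>The filtration generated by the initial loads and the first events\<close>

definition generator :: "source \<Rightarrow> 'a set set" where
  "generator s = (case s of
     Init \<Rightarrow> {X0 -` A \<inter> space M | A. A \<in> sets (load_space V)}
   | Edge j \<Rightarrow> {edge j -` A \<inter> space M | A. A \<in> sets (count_space E)}
   | Mark j \<Rightarrow> {mark j -` A \<inter> space M | A. A \<in> sets borel})"

definition past_sources :: "nat \<Rightarrow> source set" where
  "past_sources m = insert Init (Edge ` {..<m} \<union> Mark ` {..<m})"

text \<open>Events are numbered from 0, so \<open>past m\<close> knows the events before
  \<open>m\<close>: the profile \<open>X m\<close> is measurable for it, and event \<open>m\<close>
  is independent of it.\<close>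

definition past :: "nat \<Rightarrow> 'a measure" where
  "past m = sigma (space M) (\<Union>s\<in>past_sources m. generator s)"

abbreviation X :: "nat \<Rightarrow> 'a \<Rightarrow> 'v \<Rightarrow> int" where
  "X \<equiv> profile ori p X0 edge mark"

lemma finite_V: "finite V" and finite_E: "finite E"
proof -
  show "finite V" using graph by (simp add: simple_graph_def)
  then show "finite E" using graph by (auto simp: simple_graph_def intro: finite_subset[of E "Pow V"])
qed

lemma generator_subset: "generator s \<subseteq> events"
  by (cases s) (auto simp: generator_def simp del: sets_count_space
      intro!: measurable_sets[OF initial] measurable_sets[OF edge_measurable] measurable_sets[OF mark_measurable])

lemma Int_stable_generator: "Int_stable (generator s)"
  by (cases s) (simp_all add: generator_def Int_stable_vimages del: sets_count_space)

lemma space_past [simp]: "space (past m) = space M"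
  unfolding past_def by (rule space_measure_of) (use generator_subset sets.sets_into_space in blast)

lemma sets_past: "sets (past m) = sigma_sets (space M) (\<Union>s\<in>past_sources m. generator s)"
  unfolding past_def by (rule sets_measure_of) (use generator_subset sets.sets_into_space in blast)

lemma generator_past: "s \<in> past_sources m \<Longrightarrow> generator s \<subseteq> sets (past m)"
  unfolding sets_past by auto

lemma past_subset: "sets (past m) \<subseteq> events"
  unfolding sets_past by (rule sets.sigma_sets_subset) (use generator_subset in auto)

lemma past_mono: "m \<le> m' \<Longrightarrow> sets (past m) \<subseteq> sets (past m')"
  unfolding sets_past by (intro sigma_sets_mono' UN_mono order_refl) (auto simp: past_sources_def)

lemma measurable_past_mono:
  assumes "m \<le> m'" "f \<in> measurable (past m) N"
  shows "f \<in> measurable (past m') N"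
  using assms(2) past_mono[OF assms(1)] unfolding measurable_def space_past by blast

lemma measurable_past:
  assumes "f \<in> measurable (past m) N"
  shows "f \<in> measurable M N"
  using assms past_subset[of m] unfolding measurable_def space_past by blast

lemma X0_past: "X0 \<in> measurable (past m) (load_space V)"
proof (rule measurableI)
  show "X0 \<omega> \<in> space (load_space V)" if "\<omega> \<in> space (past m)" for \<omega>
    using that measurable_space[OF initial, of \<omega>] by simp
  show "X0 -` A \<inter> space (past m) \<in> sets (past m)" if "A \<in> sets (load_space V)" for A
  proof (rule subsetD[OF generator_past[of Init]])
    show "X0 -` A \<inter> space (past m) \<in> generator Init"
      unfolding generator_def source.case space_past using that by blast
  qed (simp add: past_sources_def)
qed

lemma edge_past:
  assumes "j < m"
  shows "edge j \<in> measurable (past m) (count_space E)"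
proof (rule measurableI)
  show "edge j \<omega> \<in> space (count_space E)" if "\<omega> \<in> space (past m)" for \<omega>
    using that measurable_space[OF edge_measurable[of j], of \<omega>] by simp
  show "edge j -` A \<inter> space (past m) \<in> sets (past m)" if "A \<in> sets (count_space E)" for A
  proof (rule subsetD[OF generator_past[of "Edge j"]])
    show "edge j -` A \<inter> space (past m) \<in> generator (Edge j)"
      unfolding generator_def source.case space_past using that by blast
  qed (use assms in \<open>simp add: past_sources_def\<close>)
qed

lemma mark_past:
  assumes "j < m"
  shows "mark j \<in> borel_measurable (past m)"
proof (rule measurableI)
  show "mark j -` A \<inter> space (past m) \<in> sets (past m)" if "A \<in> sets borel" for A
  proof (rule subsetD[OF generator_past[of "Mark j"]])
    show "mark j -` A \<inter> space (past m) \<in> generator (Mark j)"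
      unfolding generator_def source.case space_past using that by blast
  qed (use assms in \<open>simp add: past_sources_def\<close>)
qed simp

lemma measurable_load_space: "(f :: _ \<Rightarrow> real) \<in> borel_measurable (load_space V)"
  unfolding load_space_eq_count_space[OF finite_V] by simp

lemma ori_edge: "e \<in> E \<Longrightarrow> e = {fst (ori e), snd (ori e)}"
  and p_range: "e \<in> E \<Longrightarrow> 0 \<le> p e d" "e \<in> E \<Longrightarrow> p e d \<le> 1"
  and p_antimono: "e \<in> E \<Longrightarrow> antimono (p e)"
  using rule by (auto simp: endpoint_local_monotone_rule_def image_subset_iff)

lemma ori_in_V: "e \<in> E \<Longrightarrow> fst (ori e) \<in> V \<and> snd (ori e) \<in> V"
  using ori_edge graph unfolding simple_graph_def by blast

lemma allocate_eq: "allocate ori p e r x =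
   (if r \<le> p e (x (fst (ori e)) - x (snd (ori e))) then add_ball (fst (ori e)) x
    else add_ball (snd (ori e)) x)"
  by (simp add: allocate_def add_ball_def Let_def split: prod.split)

text \<open>The profiles live in a countable set, so preimages of single profiles suffice. Each is a
  countable union over the previous profile and the edge, where the mark enters through a
  threshold.\<close>

lemma profile_past: "X m \<in> measurable (past m) (load_space V)"
proof (induction m)
  case 0
  have "X 0 = X0" by (simp add: fun_eq_iff)
  then show ?case using X0_past by simp
next
  case (Suc m)
  define C where "C = (PiE V (\<lambda>_. UNIV) :: ('v \<Rightarrow> int) set)"
  have ls: "load_space V = count_space C" by (simp add: C_def load_space_eq_count_space finite_V)
  have cC: "countable C" unfolding C_def by (rule countable_PiE) (auto simp: finite_V)
  let ?N = "past (Suc m)"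
  have Xm: "X m \<in> measurable ?N (count_space C)"
    using measurable_past_mono[OF _ Suc] unfolding ls by simp
  have e: "edge m \<in> measurable ?N (count_space E)" and r [measurable]: "mark m \<in> borel_measurable ?N"
    by (simp_all add: edge_past mark_past)
  have XC: "X m \<omega> \<in> C" and eE: "edge m \<omega> \<in> E" if "\<omega> \<in> space M" for \<omega>
    using measurable_space[OF Xm, of \<omega>] measurable_space[OF e, of \<omega>] that by auto
  have "X (Suc m) \<in> measurable ?N (count_space C)"
    unfolding measurable_count_space_eq_countable[OF cC]
  proof (intro conjI ballI funcsetI)
    fix \<omega> assume "\<omega> \<in> space ?N"
    then show "X (Suc m) \<omega> \<in> C"
      using XC[of \<omega>] eE[of \<omega>] ori_in_V[of "edge m \<omega>"]
      by (auto simp: allocate_eq add_ball_def C_def PiE_iff extensional_def)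
  next
    fix a assume "a \<in> C"
    have eq: "X (Suc m) -` {a} \<inter> space ?N = (\<Union>x\<in>C. \<Union>e\<in>E.
        (X m -` {x} \<inter> space ?N) \<inter> (edge m -` {e} \<inter> space ?N)
        \<inter> {\<omega> \<in> space ?N. allocate ori p e (mark m \<omega>) x = a})"
      using XC eE by auto
    have "{\<omega> \<in> space ?N. allocate ori p e (mark m \<omega>) x = a} \<in> sets ?N" for e x
      unfolding allocate_eq by measurable
    moreover have "X m -` {x} \<inter> space ?N \<in> sets ?N" if "x \<in> C" for x
      using Xm that by (intro measurable_sets[OF Xm]) auto
    moreover have "edge m -` {f} \<inter> space ?N \<in> sets ?N" if "f \<in> E" for f
      using that by (intro measurable_sets[OF e]) auto
    ultimately show "X (Suc m) -` {a} \<inter> space ?N \<in> sets ?N"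
      unfolding eq
      by (intro sets.countable_UN''[OF cC] sets.countable_UN''[OF countable_finite[OF finite_E]])
        (simp add: sets.Int)
  qed
  then show ?case unfolding ls .
qed

lemma indep_past_sets:
  "indep_set (sets (past m)) (sigma_sets (space M) (generator (Edge m) \<union> generator (Mark m)))"
proof -
  define I where "I b = (if b then past_sources m else {Edge m, Mark m})" for b
  have "indep_sets generator UNIV" unfolding generator_def[abs_def] by (rule independent)
  then have ind: "indep_sets generator (\<Union>b. I b)"
    by (rule indep_sets_mono_index[OF subset_UNIV])
  have "indep_sets (\<lambda>b. sigma_sets (space M) (\<Union>s\<in>I b. generator s)) UNIV"
  proof (rule indep_sets_collect_sigma[OF ind Int_stable_generator])
    show "disjoint_family I" by (auto simp: disjoint_family_on_def I_def past_sources_def)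
  qed
  moreover have "sigma_sets (space M) (\<Union>s\<in>I b. generator s) =
    case_bool (sets (past m)) (sigma_sets (space M) (generator (Edge m) \<union> generator (Mark m))) b" for b
    by (cases b) (simp_all add: I_def sets_past)
  ultimately show ?thesis by (simp add: indep_set_def)
qed

lemma indep_past:
  assumes W: "W \<in> measurable (past m) S"
    and A: "A \<in> sets S" and B: "B \<in> sets (count_space E \<Otimes>\<^sub>M borel)"
  defines "F \<equiv> \<lambda>\<omega>. (edge m \<omega>, mark m \<omega>)"
  shows "prob ((W -` A \<inter> space M) \<inter> (F -` B \<inter> space M)) = prob (W -` A \<inter> space M) * prob (F -` B \<inter> space M)"
proof -
  let ?\<G> = "sigma (space M) (generator (Edge m) \<union> generator (Mark m))"
  have sub: "generator (Edge m) \<union> generator (Mark m) \<subseteq> Pow (space M)"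
    using generator_subset sets.sets_into_space by blast
  have e: "edge m \<in> measurable ?\<G> (count_space E)"
    unfolding measurable_def space_measure_of[OF sub] sets_measure_of[OF sub]
  proof (intro CollectI conjI ballI funcsetI)
    show "edge m \<omega> \<in> space (count_space E)" if "\<omega> \<in> space M" for \<omega>
      by (rule measurable_space[OF edge_measurable that])
    show "edge m -` A \<inter> space M \<in> sigma_sets (space M) (generator (Edge m) \<union> generator (Mark m))"
      if "A \<in> sets (count_space E)" for A
      by (rule sigma_sets.Basic, rule UnI1) (unfold generator_def source.case, use that in blast)
  qed
  have u: "mark m \<in> measurable ?\<G> borel"
    unfolding measurable_def space_measure_of[OF sub] sets_measure_of[OF sub]
  proof (intro CollectI conjI ballI funcsetI)
    show "mark m -` A \<inter> space M \<in> sigma_sets (space M) (generator (Edge m) \<union> generator (Mark m))"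
      if "A \<in> sets borel" for A
      by (rule sigma_sets.Basic, rule UnI2) (unfold generator_def source.case, use that in blast)
  qed simp
  have F: "F \<in> measurable ?\<G> (count_space E \<Otimes>\<^sub>M borel)"
    unfolding F_def using e u by (rule measurable_Pair)
  have "W -` A \<inter> space M \<in> sets (past m)" using measurable_sets[OF W A] by simp
  moreover have "F -` B \<inter> space M \<in> sigma_sets (space M) (generator (Edge m) \<union> generator (Mark m))"
    using measurable_sets[OF F B] by (simp add: space_measure_of[OF sub] sets_measure_of[OF sub])
  ultimately show ?thesis
    using indep_past_sets[of m] unfolding indep_sets2_eq by blast
qed

section \<open>The law of a single edge and mark\<close>

lemma prob_edge:
  assumes "e \<in> E"
  shows "prob {\<omega> \<in> space M. edge j \<omega> = e} = 1 / card E"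
proof -
  have "prob {\<omega> \<in> space M. edge j \<omega> = e} = measure (distr M (count_space E) (edge j)) {e}"
    using assms edge_measurable by (subst measure_distr) (auto intro!: arg_cong[where f=prob])
  also have "\<dots> = 1 / card E"
    unfolding edge_uniform using assms finite_E by (simp add: measure_uniform_count_measure)
  finally show ?thesis .
qed

lemma prob_mark:
  assumes "0 \<le> t" "t \<le> 1"
  shows "prob {\<omega> \<in> space M. mark j \<omega> \<le> t} = t"
proof -
  have "emeasure lborel ({0<..<1} \<inter> {..t}) = ennreal t"
  \<comment> \<open>The mark lies in the open interval, so the intersection is
    \<open>{0<..t}\<close> except for \<open>t = 1\<close>.\<close>
  proof (cases "t = 1")
    case True
    then have "{0<..<1} \<inter> {..t} = {0<..<1}" by auto
    then show ?thesis using True by simp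
  next
    case False
    then have "{0<..<1} \<inter> {..t} = {0<..t}" using assms by auto
    then show ?thesis using assms by simp
  qed
  then have "measure (uniform_measure lborel {0<..<1}) {..t} = t"
    using assms by (simp add: measure_def divide_ennreal[of t 1, simplified])
  moreover have "prob {\<omega> \<in> space M. mark j \<omega> \<le> t} = measure (distr M lborel (mark j)) {..t}"
    using mark_measurable by (subst measure_distr) (auto intro!: arg_cong[where f=prob])
  ultimately show ?thesis by (simp add: mark_uniform)
qed

lemma prob_edge_mark:
  assumes "e \<in> E" "0 \<le> t" "t \<le> 1"
  shows "prob {\<omega> \<in> space M. edge j \<omega> = e \<and> mark j \<omega> \<le> t} = t / card E"
proof -
  let ?A = "\<lambda>s. case s of Edge _ \<Rightarrow> {\<omega> \<in> space M. edge j \<omega> = e} | _ \<Rightarrow> {\<omega> \<in> space M. mark j \<omega> \<le> t}"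
  have ind: "indep_sets generator UNIV" unfolding generator_def[abs_def] by (rule independent)
  have "{\<omega> \<in> space M. edge j \<omega> = e} \<in> generator (Edge j)"
    using assms(1) unfolding generator_def by (auto intro!: exI[of _ "{e}"])
  moreover have "{\<omega> \<in> space M. mark j \<omega> \<le> t} \<in> generator (Mark j)"
    unfolding generator_def by (auto intro!: exI[of _ "{..t}"])
  ultimately have "?A s \<in> generator s" if "s \<in> {Edge j, Mark j}" for s
    using that by auto
  then have "prob (\<Inter>s\<in>{Edge j, Mark j}. ?A s) = (\<Prod>s\<in>{Edge j, Mark j}. prob (?A s))"
    by (intro indep_setsD[OF ind]) auto
  also have "(\<Inter>s\<in>{Edge j, Mark j}. ?A s) = {\<omega> \<in> space M. edge j \<omega> = e \<and> mark j \<omega> \<le> t}" by auto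
  also have "(\<Prod>s\<in>{Edge j, Mark j}. prob (?A s)) = t / card E"
    using prob_edge[OF assms(1)] prob_mark assms by simp
  finally show ?thesis .
qed

text \<open>Given the past, edge \<open>e\<close> is drawn with probability
  \<open>1 / card E\<close> and the mark decides between its ends. Testing against an arbitrary
  bounded past observable \<open>Y\<close> takes the place of a conditional expectation.\<close>

lemma expectation_allocate:
  fixes f :: "('v \<Rightarrow> int) \<Rightarrow> real"
  assumes Y: "Y \<in> borel_measurable (past m)" "\<And>\<omega>. \<bar>Y \<omega>\<bar> \<le> B" and f: "\<And>x. \<bar>f x\<bar> \<le> K" and e: "e \<in> E"
  defines "t \<equiv> \<lambda>x. p e (x (fst (ori e)) - x (snd (ori e)))"
  shows "expectation (\<lambda>\<omega>. Y \<omega> * (if edge m \<omega> = e then f (X (Suc m) \<omega>) else 0))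
    = expectation (\<lambda>\<omega>. Y \<omega> * (t (X m \<omega>) * f (add_ball (fst (ori e)) (X m \<omega>))
        + (1 - t (X m \<omega>)) * f (add_ball (snd (ori e)) (X m \<omega>)))) / card E"
proof -
  define a where "a x = f (add_ball (fst (ori e)) x)" for x
  define b where "b x = f (add_ball (snd (ori e)) x)" for x
  \<comment> \<open>Clamping the first argument to \<open>[-B, B]\<close> makes \<open>h\<close>
    bounded on the whole product space; values of \<open>Y\<close> are not affected
    (\<open>YB\<close>).\<close>
  define h where "h = (\<lambda>z. max (-B) (min B (fst (fst z))) * (if fst (snd z) = e
    then if snd (snd z) \<le> t (snd (fst z)) then a (snd (fst z)) else b (snd (fst z)) else 0))"
  have [measurable]: "a \<in> borel_measurable (load_space V)" "b \<in> borel_measurable (load_space V)"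
    "t \<in> borel_measurable (load_space V)" by (rule measurable_load_space)+
  have W: "(\<lambda>\<omega>. (Y \<omega>, X m \<omega>)) \<in> measurable (past m) (borel \<Otimes>\<^sub>M load_space V)"
    using Y(1) profile_past by measurable
  have B0: "0 \<le> B" using Y(2)[of undefined] by simp
  have [measurable]: "Measurable.pred (count_space E) (\<lambda>d. d = e)" by simp
  have h: "h \<in> borel_measurable ((borel \<Otimes>\<^sub>M load_space V) \<Otimes>\<^sub>M (count_space E \<Otimes>\<^sub>M borel))"
    unfolding h_def by measurable
  have hb: "\<bar>h z\<bar> \<le> B * K" for z
  proof -
    obtain y x d u where z: "z = ((y, x), (d, u))" by (metis surj_pair)
    have "\<bar>max (-B) (min B y)\<bar> \<le> B" using B0 by auto
    moreover have "\<bar>if d = e then if u \<le> t x then a x else b x else 0\<bar> \<le> K"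
      using f[of "add_ball (fst (ori e)) x"] f[of "add_ball (snd (ori e)) x"]
      by (auto simp: a_def b_def)
    ultimately show ?thesis unfolding z h_def using B0
      by (simp only: abs_mult fst_conv snd_conv) (intro mult_mono, auto)
  qed
  have YB: "max (-B) (min B (Y \<omega>)) = Y \<omega>" for \<omega> using Y(2)[of \<omega>] by auto
  have inner: "expectation (\<lambda>\<omega>'. h ((Y \<omega>, X m \<omega>), (edge m \<omega>', mark m \<omega>')))
    = Y \<omega> * (t (X m \<omega>) * a (X m \<omega>) + (1 - t (X m \<omega>)) * b (X m \<omega>)) / card E" for \<omega>
  proof -
    define x where "x = X m \<omega>"
    define A1 where "A1 = {\<omega> \<in> space M. edge m \<omega> = e \<and> mark m \<omega> \<le> t x}"
    define A2 where "A2 = {\<omega> \<in> space M. edge m \<omega> = e}"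
    note [measurable] = edge_measurable mark_measurable
    have A: "A1 \<in> events" "A2 \<in> events" unfolding A1_def A2_def by measurable
    have "expectation (\<lambda>\<omega>'. h ((Y \<omega>, x), (edge m \<omega>', mark m \<omega>')))
      = expectation (\<lambda>\<omega>'. Y \<omega> * (a x - b x) * indicator A1 \<omega>' + Y \<omega> * b x * indicator A2 \<omega>')"
      by (rule Bochner_Integration.integral_cong[OF refl])
        (auto simp: h_def YB A1_def A2_def indicator_def algebra_simps)
    also have "\<dots> = Y \<omega> * (a x - b x) * prob A1 + Y \<omega> * b x * prob A2"
      using A by (simp add: emeasure_eq_measure)
    also have "\<dots> = Y \<omega> * (t x * a x + (1 - t x) * b x) / card E"
      using prob_edge[OF e, of m] prob_edge_mark[OF e, of "t x" m] p_range[OF e]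
      by (simp add: A1_def A2_def t_def algebra_simps add_divide_distrib diff_divide_distrib)
    finally show ?thesis unfolding x_def .
  qed
  have "expectation (\<lambda>\<omega>. Y \<omega> * (if edge m \<omega> = e then f (X (Suc m) \<omega>) else 0))
    = expectation (\<lambda>\<omega>. h ((Y \<omega>, X m \<omega>), (edge m \<omega>, mark m \<omega>)))"
    by (rule Bochner_Integration.integral_cong[OF refl])
      (auto simp: h_def YB allocate_eq a_def b_def t_def)
  also have "\<dots> = expectation (\<lambda>\<omega>. Y \<omega> * (t (X m \<omega>) * a (X m \<omega>) + (1 - t (X m \<omega>)) * b (X m \<omega>)) / card E)"
    by (subst expectation_independent_pair[OF measurable_past[OF W] _ indep_past[OF W] h hb])
      (auto simp: inner intro!: measurable_Pair edge_measurable mark_measurable)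
  finally show ?thesis by (simp add: a_def b_def)
qed

end

section \<open>The process on the cycle\<close>

context prob_space
begin

lemma integrable_bounded:
  fixes f :: "'a \<Rightarrow> real"
  assumes "f \<in> borel_measurable M" "\<And>\<omega>. \<bar>f \<omega>\<bar> \<le> B"
  shows "integrable M f"
  by (rule integrable_const_bound[where B=B]) (use assms in auto)

lemma expectation_abs_diff_le:
  fixes f g :: "'a \<Rightarrow> real"
  assumes "integrable M f" "integrable M g" "\<And>\<omega>. \<bar>f \<omega> - g \<omega>\<bar> \<le> B"
  shows "\<bar>expectation f - expectation g\<bar> \<le> B"
proof -
  have "\<bar>expectation f - expectation g\<bar> = \<bar>expectation (\<lambda>\<omega>. f \<omega> - g \<omega>)\<bar>"
    using assms by simp
  also have "\<dots> \<le> expectation (\<lambda>\<omega>. \<bar>f \<omega> - g \<omega>\<bar>)" by (rule integral_abs_bound)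
  also have "\<dots> \<le> expectation (\<lambda>_. B)"
    using assms by (intro integral_mono) auto
  finally show ?thesis by (simp add: prob_space)
qed

end

section \<open>Reduction to the clockwise form of the rule\<close>

locale cycle_process =
  allocation_process M "cycle_vertices n" "cycle_edges n" ori p X0 edge mark
  for M :: "'a measure" and n :: nat and ori :: "nat set \<Rightarrow> nat \<times> nat"
    and p :: "nat set \<Rightarrow> int \<Rightarrow> real" and X0 :: "'a \<Rightarrow> nat \<Rightarrow> int"
    and edge :: "nat \<Rightarrow> 'a \<Rightarrow> nat set" and mark :: "nat \<Rightarrow> 'a \<Rightarrow> real" +
  assumes n_ge_3: "n \<ge> 3"
begin

definition cedge :: "nat \<Rightarrow> nat set" where "cedge i = {i, Suc i mod n}"

text \<open>If the orientation starts at the right end, the rule sees \<open>- d\<close> and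
  \<open>p\<close> is the probability of the right end; the two reversals together keep the function
  nonincreasing.\<close>

definition left_prob :: "nat \<Rightarrow> int \<Rightarrow> real" where
  "left_prob i d = (if fst (ori (cedge i)) = i then p (cedge i) d else 1 - p (cedge i) (- d))"

lemma cedge_in: "i < n \<Longrightarrow> cedge i \<in> cycle_edges n"
  by (auto simp: cedge_def cycle_edges_def)

sublocale cycle_dynamics n left_prob
proof
  show "3 \<le> n" by (rule n_ge_3)
  show "left_prob i d' \<le> left_prob i d" if "i < n" "d \<le> d'" for i d d'
    using antimonoD[OF p_antimono[OF cedge_in[OF that(1)]], of d d']
      antimonoD[OF p_antimono[OF cedge_in[OF that(1)]], of "- d'" "- d"] that(2)
    by (auto simp: left_prob_def)
  show "0 \<le> left_prob i d" "left_prob i d \<le> 1" if "i < n" for i d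
    using p_range[OF cedge_in[OF that]] by (auto simp: left_prob_def)
qed

lemma cedge_nx: "cedge i = {i, nx i}"
  by (simp add: cedge_def nx_def)

lemma cedge_inj: "i < n \<Longrightarrow> j < n \<Longrightarrow> cedge i = cedge j \<longleftrightarrow> i = j"
  using nx_nx_neq[of i] nx_nx_neq[of j] by (auto simp: cedge_nx doubleton_eq_iff)

lemma ev_eq:
  fixes x :: "nat \<Rightarrow> int"
  assumes i: "i < n"
  defines "u \<equiv> fst (ori (cedge i))" and "v \<equiv> snd (ori (cedge i))"
  shows "p (cedge i) (x u - x v) * f (add_ball u x) + (1 - p (cedge i) (x u - x v)) * f (add_ball v x) = ev i f x"
proof -
  have "{i, nx i} = {u, v}" using ori_edge[OF cedge_in[OF i]] by (simp add: u_def v_def cedge_nx)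
  then consider "u = i" "v = nx i" | "u = nx i" "v = i" by (auto simp: doubleton_eq_iff)
  then show ?thesis
  proof cases
    case 1
    then show ?thesis by (simp add: ev_def left_prob_def u_def)
  next
    case 2
    then have "fst (ori (cedge i)) \<noteq> i" using i by (simp add: u_def)
    then show ?thesis unfolding 2 by (simp add: ev_def left_prob_def)
  qed
qed

text \<open>This is the weight of the edge drawn at event \<open>m\<close>: distinct indices give
  distinct edges, so at most one term survives.\<close>

definition weight :: "(nat \<Rightarrow> real) \<Rightarrow> nat \<Rightarrow> 'a \<Rightarrow> real" where
  "weight \<phi> m \<omega> = (\<Sum>i<n. if edge m \<omega> = cedge i then \<phi> i else 0)"

lemma weight_at: "edge m \<omega> = cedge i \<Longrightarrow> i < n \<Longrightarrow> weight \<phi> m \<omega> = \<phi> i"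
  by (simp add: weight_def cedge_inj cong: if_cong)

lemma edge_cases:
  assumes "\<omega> \<in> space M"
  obtains i where "i < n" "edge m \<omega> = cedge i"
proof -
  have "edge m \<omega> \<in> cycle_edges n" using measurable_space[OF edge_measurable assms] by simp
  then show ?thesis using that by (auto simp: cycle_edges_def cedge_def)
qed

lemma weight_abs_le:
  fixes h :: real
  assumes "\<And>i. i < n \<Longrightarrow> \<bar>\<phi> i\<bar> \<le> h" "0 \<le> h"
  shows "\<bar>weight \<phi> m \<omega>\<bar> \<le> h"
proof (cases "\<exists>i<n. edge m \<omega> = cedge i")
  case True
  then show ?thesis using assms weight_at by metis
next
  case False
  then have "weight \<phi> m \<omega> = 0" by (auto simp: weight_def intro!: sum.neutral)
  then show ?thesis using assms by simp
qed

lemma weight_past: "j < m \<Longrightarrow> weight \<phi> j \<in> borel_measurable (past m)"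
  unfolding weight_def[abs_def]
  by (intro borel_measurable_sum measurable_compose[OF edge_past, of j m "\<lambda>e. if e = cedge _ then \<phi> _ else 0"]) auto

lemma weight_measurable: "weight \<phi> j \<in> borel_measurable M"
  by (rule measurable_past[OF weight_past[of j "Suc j"]]) simp

lemma comp_profile_past: "(\<lambda>\<omega>. f (X m \<omega>) :: real) \<in> borel_measurable (past m)"
  by (rule measurable_compose[OF profile_past measurable_load_space])

lemma comp_profile_measurable [measurable]: "(\<lambda>\<omega>. f (X m \<omega>) :: real) \<in> borel_measurable M"
  by (rule measurable_past[OF comp_profile_past])

text \<open>Split by the edge drawn: edge \<open>i\<close> has probability \<open>1 / n\<close>,
  contributes the factor \<open>\<phi> i\<close> and acts by \<open>ev i\<close>.\<close>

lemma expectation_wev: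
  assumes Y: "Y \<in> borel_measurable (past m)" "\<And>\<omega>. \<bar>Y \<omega>\<bar> \<le> B" and f: "\<And>x. \<bar>f x\<bar> \<le> K"
  shows "expectation (\<lambda>\<omega>. Y \<omega> * weight \<phi> m \<omega> * f (X (Suc m) \<omega>)) = expectation (\<lambda>\<omega>. Y \<omega> * wev \<phi> f (X m \<omega>)) / n"
proof -
  note [measurable] = measurable_past[OF Y(1)] edge_measurable
  have B0: "0 \<le> B" and K0: "0 \<le> K" using Y(2)[of undefined] f[of undefined] by auto
  define T where "T i \<omega> = Y \<omega> * (if edge m \<omega> = cedge i then f (X (Suc m) \<omega>) else 0)" for i \<omega>
  have [measurable]: "Measurable.pred M (\<lambda>\<omega>. edge m \<omega> = cedge i)" for i
    by (rule measurable_compose[OF edge_measurable, of "\<lambda>e. e = cedge i"]) simp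
  have Tint: "integrable M (T i)" for i
  proof (rule integrable_bounded)
    show "T i \<in> borel_measurable M" unfolding T_def[abs_def] by measurable
    show "\<bar>T i \<omega>\<bar> \<le> B * K" for \<omega>
      unfolding T_def abs_mult using Y(2) f B0 K0 by (intro mult_mono) auto
  qed
  have evint: "integrable M (\<lambda>\<omega>. Y \<omega> * ev i f (X m \<omega>))" if "i < n" for i
  proof (rule integrable_bounded)
    show "(\<lambda>\<omega>. Y \<omega> * ev i f (X m \<omega>)) \<in> borel_measurable M" by measurable
    show "\<bar>Y \<omega> * ev i f (X m \<omega>)\<bar> \<le> B * K" for \<omega>
      unfolding abs_mult using Y(2) ev_abs_le[OF that f] B0 K0 by (intro mult_mono) auto
  qed
  have ET: "expectation (T i) = expectation (\<lambda>\<omega>. Y \<omega> * ev i f (X m \<omega>)) / n" if "i < n" for i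
    using expectation_allocate[where f=f, OF Y f cedge_in[OF that]] ev_eq[OF that, of _ f]
    by (simp add: T_def[abs_def] card_cycle_edges[OF n_ge_3])
  have "expectation (\<lambda>\<omega>. Y \<omega> * weight \<phi> m \<omega> * f (X (Suc m) \<omega>)) = expectation (\<lambda>\<omega>. \<Sum>i<n. \<phi> i * T i \<omega>)"
    by (rule Bochner_Integration.integral_cong[OF refl])
      (auto simp: weight_def T_def sum_distrib_left sum_distrib_right intro!: sum.cong)
  also have "\<dots> = (\<Sum>i<n. \<phi> i * expectation (T i))"
    using Tint by simp
  also have "\<dots> = (\<Sum>i<n. \<phi> i * expectation (\<lambda>\<omega>. Y \<omega> * ev i f (X m \<omega>))) / n"
    using ET by (simp add: sum_divide_distrib)
  also have "(\<Sum>i<n. \<phi> i * expectation (\<lambda>\<omega>. Y \<omega> * ev i f (X m \<omega>)))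
      = expectation (\<lambda>\<omega>. \<Sum>i<n. \<phi> i * (Y \<omega> * ev i f (X m \<omega>)))"
    using evint by simp
  also have "\<dots> = expectation (\<lambda>\<omega>. Y \<omega> * wev \<phi> f (X m \<omega>))"
    by (simp add: wev_def sum_distrib_left mult_ac)
  finally show ?thesis .
qed

lemma weight_one: "\<omega> \<in> space M \<Longrightarrow> weight (\<lambda>_. 1) m \<omega> = 1"
  by (rule edge_cases[of \<omega> m]) (simp_all add: weight_at)

text \<open>The Markov property: with all weights equal to one, \<open>expectation_wev\<close>
  replaces the last event by \<open>step\<close>, and the induction removes events from the
  end.\<close>

lemma expectation_step_pow:
  assumes Y: "Y \<in> borel_measurable (past m)" "\<And>\<omega>. \<bar>Y \<omega>\<bar> \<le> B" and f: "\<And>x. \<bar>f x\<bar> \<le> K"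
  shows "expectation (\<lambda>\<omega>. Y \<omega> * f (X (m + r) \<omega>)) = expectation (\<lambda>\<omega>. Y \<omega> * (step ^^ r) f (X m \<omega>))"
  using f
proof (induction r arbitrary: f)
  case (Suc r)
  have "expectation (\<lambda>\<omega>. Y \<omega> * f (X (m + Suc r) \<omega>))
      = expectation (\<lambda>\<omega>. Y \<omega> * weight (\<lambda>_. 1) (m + r) \<omega> * f (X (Suc (m + r)) \<omega>))"
    by (rule Bochner_Integration.integral_cong[OF refl]) (simp add: weight_one)
  also have "\<dots> = expectation (\<lambda>\<omega>. Y \<omega> * wev (\<lambda>_. 1) f (X (m + r) \<omega>)) / n"
    by (rule expectation_wev[OF measurable_past_mono[OF _ Y(1)] Y(2) Suc.prems]) simp
  also have "\<dots> = expectation (\<lambda>\<omega>. Y \<omega> * step f (X (m + r) \<omega>))"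
    unfolding step_def wev_def by simp
  also have "\<dots> = expectation (\<lambda>\<omega>. Y \<omega> * (step ^^ r) (step f) (X m \<omega>))"
    by (rule Suc.IH) (rule step_abs_le[OF Suc.prems])
  finally show ?case by (simp add: funpow_swap1)
qed simp

lemma wev_abs_le:
  fixes h K :: real
  assumes "\<And>i. i < n \<Longrightarrow> \<bar>\<phi> i\<bar> \<le> h" "\<And>x. \<bar>f x\<bar> \<le> K"
  shows "\<bar>wev \<phi> f x\<bar> \<le> real n * (h * K)"
proof -
  have h0: "0 \<le> h" using assms(1)[of 0] n_ge_3 by auto
  have "\<bar>wev \<phi> f x\<bar> \<le> (\<Sum>i<n. h * K)"
    unfolding wev_def
    by (intro order_trans[OF sum_abs sum_mono])
      (auto simp: abs_mult h0 intro!: mult_mono ev_abs_le assms)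
  then show ?thesis by simp
qed

text \<open>The \<open>r\<close> events after \<open>s\<close> act on \<open>f\<close> as a power of
  \<open>step\<close>, and event \<open>s\<close> as the weighted operator. Commuting the two moves
  the weighted operator next to \<open>f\<close>, so that the main term depends on
  \<open>s + r\<close> only.\<close>

lemma expectation_weight_profile:
  fixes h K :: real
  assumes f: "\<And>x. \<bar>f x\<bar> \<le> K"
    and grad: "\<And>x j. j < n \<Longrightarrow> \<bar>f (add_ball (nx j) x) - f (add_ball j x)\<bar> \<le> w j"
    and h: "\<And>i. i < n \<Longrightarrow> \<bar>\<phi> i\<bar> \<le> h"
    and slope: "\<And>i. i < n \<Longrightarrow> \<bar>\<phi> (nx i) - \<phi> i\<bar> \<le> 1"
  shows "\<bar>expectation (\<lambda>\<omega>. weight \<phi> s \<omega> * f (X (Suc (s + r)) \<omega>))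
      - expectation (\<lambda>\<omega>. wev \<phi> f (X (s + r) \<omega>)) / n\<bar> \<le> r * (2 * (\<Sum>i<n. w i) / n) / n"
proof -
  have h0: "0 \<le> h" using h[of 0] n_ge_3 by auto
  have "expectation (\<lambda>\<omega>. weight \<phi> s \<omega> * f (X (Suc s + r) \<omega>))
    = expectation (\<lambda>\<omega>. weight \<phi> s \<omega> * (step ^^ r) f (X (Suc s) \<omega>))"
    by (rule expectation_step_pow[OF weight_past weight_abs_le[OF h h0] f]) simp
  also have "\<dots> = expectation (\<lambda>\<omega>. 1 * weight \<phi> s \<omega> * (step ^^ r) f (X (Suc s) \<omega>))" by simp
  also have "\<dots> = expectation (\<lambda>\<omega>. 1 * wev \<phi> ((step ^^ r) f) (X s \<omega>)) / n"
    by (rule expectation_wev[OF _ _ step_pow_abs_le[OF f], where B=1]) auto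
  finally have 1: "expectation (\<lambda>\<omega>. weight \<phi> s \<omega> * f (X (Suc (s + r)) \<omega>))
    = expectation (\<lambda>\<omega>. wev \<phi> ((step ^^ r) f) (X s \<omega>)) / n" by simp
  have "expectation (\<lambda>\<omega>. 1 * wev \<phi> f (X (s + r) \<omega>)) = expectation (\<lambda>\<omega>. 1 * (step ^^ r) (wev \<phi> f) (X s \<omega>))"
    by (rule expectation_step_pow[OF _ _ wev_abs_le[OF h f], where B=1]) auto
  then have 2: "expectation (\<lambda>\<omega>. wev \<phi> f (X (s + r) \<omega>)) = expectation (\<lambda>\<omega>. (step ^^ r) (wev \<phi> f) (X s \<omega>))"
    by simp
  have "\<bar>expectation (\<lambda>\<omega>. wev \<phi> ((step ^^ r) f) (X s \<omega>)) - expectation (\<lambda>\<omega>. (step ^^ r) (wev \<phi> f) (X s \<omega>))\<bar>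
    \<le> r * (2 * (\<Sum>i<n. w i) / n)"
  proof (rule expectation_abs_diff_le)
    show "integrable M (\<lambda>\<omega>. wev \<phi> ((step ^^ r) f) (X s \<omega>))"
      by (rule integrable_bounded[OF comp_profile_measurable wev_abs_le[OF h step_pow_abs_le[OF f]]])
    show "integrable M (\<lambda>\<omega>. (step ^^ r) (wev \<phi> f) (X s \<omega>))"
      by (rule integrable_bounded[OF comp_profile_measurable step_pow_abs_le[OF wev_abs_le[OF h f]]])
    show "\<bar>wev \<phi> ((step ^^ r) f) (X s \<omega>) - (step ^^ r) (wev \<phi> f) (X s \<omega>)\<bar> \<le> r * (2 * (\<Sum>i<n. w i) / n)" for \<omega>
      using step_pow_wev_commutator_le[where f=f and w=w and \<phi>=\<phi>, OF grad slope, of r "X s \<omega>"] by (simp add: abs_minus_commute)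
  qed
  then have "\<bar>expectation (\<lambda>\<omega>. wev \<phi> ((step ^^ r) f) (X s \<omega>)) - expectation (\<lambda>\<omega>. (step ^^ r) (wev \<phi> f) (X s \<omega>))\<bar> / n
    \<le> r * (2 * (\<Sum>i<n. w i) / n) / n" by (rule divide_right_mono) simp
  then show ?thesis unfolding 1 2 by (simp add: diff_divide_distrib[symmetric] abs_divide)
qed

section \<open>Moments of the edge weights\<close>

lemma wev_const: "wev \<phi> (\<lambda>_. c) x = (\<Sum>i<n. \<phi> i) * c"
  by (simp add: wev_def ev_def algebra_simps sum_distrib_left)

lemma expectation_weight: "expectation (weight \<phi> s) = (\<Sum>i<n. \<phi> i) / n"
  using expectation_wev[of "\<lambda>_. 1" s 1 "\<lambda>_. 1" 1 \<phi>] by (simp add: wev_const prob_space)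

text \<open>Given the events before \<open>r\<close>, the weight at \<open>r\<close> has mean
  \<open>(\<Sum>i<n. \<phi> i) / n\<close>, which is zero: the weights are martingale
  differences.\<close>

lemma expectation_weight_mult:
  fixes \<phi> :: "nat \<Rightarrow> real"
  assumes "(\<Sum>i<n. \<phi> i) = 0" "s < r"
  shows "expectation (\<lambda>\<omega>. weight \<phi> s \<omega> * weight \<phi> r \<omega>) = 0"
proof -
  have "\<bar>weight \<phi> s \<omega>\<bar> \<le> (\<Sum>i<n. \<bar>\<phi> i\<bar>)" for \<omega>
    by (rule weight_abs_le) (auto intro: member_le_sum sum_nonneg)
  from expectation_wev[OF weight_past[OF assms(2)] this, of "\<lambda>_. 1" 1 \<phi>] assms(1)
  show ?thesis by (simp add: wev_const)
qed

lemma expectation_weight_square: "expectation (\<lambda>\<omega>. (weight \<phi> s \<omega>)\<^sup>2) = (\<Sum>i<n. (\<phi> i)\<^sup>2) / n"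
proof -
  have "expectation (\<lambda>\<omega>. (weight \<phi> s \<omega>)\<^sup>2) = expectation (weight (\<lambda>i. (\<phi> i)\<^sup>2) s)"
    by (rule Bochner_Integration.integral_cong[OF refl]) (use weight_at in \<open>auto elim!: edge_cases[of _ s]\<close>)
  then show ?thesis by (simp add: expectation_weight)
qed

lemma integrable_weight_mult: "integrable M (\<lambda>\<omega>. weight \<phi> s \<omega> * weight \<phi> r \<omega>)"
proof (rule integrable_bounded)
  show "(\<lambda>\<omega>. weight \<phi> s \<omega> * weight \<phi> r \<omega>) \<in> borel_measurable M"
    using weight_measurable by measurable
  have "\<bar>weight \<phi> s \<omega>\<bar> \<le> (\<Sum>i<n. \<bar>\<phi> i\<bar>)" for \<omega> s
    by (rule weight_abs_le) (auto intro: member_le_sum sum_nonneg)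
  then show "\<bar>weight \<phi> s \<omega> * weight \<phi> r \<omega>\<bar> \<le> (\<Sum>i<n. \<bar>\<phi> i\<bar>) * (\<Sum>i<n. \<bar>\<phi> i\<bar>)" for \<omega>
    unfolding abs_mult by (intro mult_mono) (auto intro: sum_nonneg)
qed

lemma weight_sum_second_moment:
  fixes \<phi> :: "nat \<Rightarrow> real"
  assumes "(\<Sum>i<n. \<phi> i) = 0" "finite A"
  shows "integrable M (\<lambda>\<omega>. (\<Sum>s\<in>A. weight \<phi> s \<omega>)\<^sup>2)"
    and "expectation (\<lambda>\<omega>. (\<Sum>s\<in>A. weight \<phi> s \<omega>)\<^sup>2) = card A * (\<Sum>i<n. (\<phi> i)\<^sup>2) / n"
proof -
  have sq: "(\<Sum>s\<in>A. weight \<phi> s \<omega>)\<^sup>2 = (\<Sum>s\<in>A. \<Sum>r\<in>A. weight \<phi> s \<omega> * weight \<phi> r \<omega>)" for \<omega>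
    by (simp add: power2_eq_square sum_product)
  show "integrable M (\<lambda>\<omega>. (\<Sum>s\<in>A. weight \<phi> s \<omega>)\<^sup>2)"
    unfolding sq by (intro Bochner_Integration.integrable_sum integrable_weight_mult)
  have "expectation (\<lambda>\<omega>. (\<Sum>s\<in>A. weight \<phi> s \<omega>)\<^sup>2)
    = (\<Sum>s\<in>A. \<Sum>r\<in>A. expectation (\<lambda>\<omega>. weight \<phi> s \<omega> * weight \<phi> r \<omega>))"
    unfolding sq by (simp add: integrable_weight_mult)
  also have "\<dots> = (\<Sum>s\<in>A. \<Sum>r\<in>A. if s = r then (\<Sum>i<n. (\<phi> i)\<^sup>2) / n else 0)"
  proof (intro sum.cong refl)
    fix s r
    show "expectation (\<lambda>\<omega>. weight \<phi> s \<omega> * weight \<phi> r \<omega>) = (if s = r then (\<Sum>i<n. (\<phi> i)\<^sup>2) / n else 0)"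
      using expectation_weight_mult[OF assms(1), of s r] expectation_weight_mult[OF assms(1), of r s]
        expectation_weight_square[of \<phi> s]
      by (cases s r rule: linorder_cases) (auto simp: power2_eq_square mult.commute)
  qed
  also have "\<dots> = card A * (\<Sum>i<n. (\<phi> i)\<^sup>2) / n" using assms(2) by simp
  finally show "expectation (\<lambda>\<omega>. (\<Sum>s\<in>A. weight \<phi> s \<omega>)\<^sup>2) = card A * (\<Sum>i<n. (\<phi> i)\<^sup>2) / n" .
qed

end

section \<open>The correlation inequality\<close>

definition cutoff :: "real \<Rightarrow> real \<Rightarrow> real" where
  "cutoff c z = max (- c) (min c z)"

lemma cutoff_abs_le: "0 \<le> c \<Longrightarrow> \<bar>cutoff c z\<bar> \<le> c"
  by (auto simp: cutoff_def)

lemma cutoff_lipschitz: "\<bar>cutoff c y - cutoff c z\<bar> \<le> \<bar>y - z\<bar>"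
  unfolding cutoff_def by linarith

text \<open>The cutoff is nondecreasing: where it acts, a move may be lost but is never
  reversed.\<close>

lemma mult_cutoff_diff_nonneg: "0 \<le> a * (cutoff c (z + a) - cutoff c z)"
proof (cases "0 \<le> a")
  case True
  then have "cutoff c z \<le> cutoff c (z + a)" by (simp add: cutoff_def)
  then show ?thesis using True by simp
next
  case False
  then have "cutoff c (z + a) \<le> cutoff c z" by (simp add: cutoff_def)
  then show ?thesis using False by (simp add: mult_nonpos_nonpos)
qed

lemma cutoff_id: "\<bar>z\<bar> \<le> c \<Longrightarrow> cutoff c z = z"
  by (auto simp: cutoff_def)

text \<open>A rise to \<open>h\<close>, a fall to \<open>- h\<close> at \<open>3 * h\<close> and a
  return to zero, all of unit slope. The absolute sum, the variation and the sum of squares then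
  have orders \<open>h\<^sup>2\<close>, \<open>h\<close> and \<open>h\<^sup>3\<close>.\<close>

definition tent :: "nat \<Rightarrow> nat \<Rightarrow> real" where
  "tent h i = (if i \<le> h then real i else if i \<le> 3 * h then 2 * real h - real i
     else if i \<le> 4 * h then real i - 4 * real h else 0)"

lemma tent_abs_le: "\<bar>tent h i\<bar> \<le> h"
  by (auto simp: tent_def)

lemma tent_beyond: "4 * h \<le> i \<Longrightarrow> tent h i = 0"
  by (auto simp: tent_def)

lemma tent_slope: "\<bar>tent h (Suc i) - tent h i\<bar> \<le> 1"
  by (auto simp: tent_def)

lemma tent_antisymmetric: "i < 2 * h \<Longrightarrow> tent h (2 * h + i) = - tent h i"
  by (auto simp: tent_def)

lemma sum_tent_support:
  fixes F :: "nat \<Rightarrow> real"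
  assumes "4 * h \<le> n" "\<And>i. 4 * h \<le> i \<Longrightarrow> i < n \<Longrightarrow> F i = 0"
  shows "(\<Sum>i<n. F i) = (\<Sum>i<4 * h. F i)"
  by (rule sum.mono_neutral_right) (use assms in auto)

lemma sum_tent:
  assumes "4 * h \<le> n"
  shows "(\<Sum>i<n. tent h i) = 0"
proof -
  have split: "(\<Sum>i<a + b. F i) = (\<Sum>i<a. F i) + (\<Sum>i<b. F (a + i))" for a b and F :: "nat \<Rightarrow> real"
    by (induction b) auto
  have "(\<Sum>i<n. tent h i) = (\<Sum>i<2 * h + 2 * h. tent h i)"
    using sum_tent_support[OF assms, of "tent h"] tent_beyond by simp
  also have "\<dots> = 0" unfolding split by (simp add: tent_antisymmetric sum_negf)
  finally show ?thesis .
qed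

lemma sum_abs_tent_le:
  assumes "4 * h \<le> n"
  shows "(\<Sum>i<n. \<bar>tent h i\<bar>) \<le> 4 * (real h)\<^sup>2"
proof -
  have "(\<Sum>i<n. \<bar>tent h i\<bar>) = (\<Sum>i<4 * h. \<bar>tent h i\<bar>)"
    using tent_beyond by (intro sum_tent_support[OF assms]) auto
  also have "\<dots> \<le> (\<Sum>i<4 * h. real h)" using tent_abs_le by (intro sum_mono) auto
  finally show ?thesis by (simp add: power2_eq_square)
qed

lemma sum_squares_tent_ge:
  assumes "4 * h \<le> n" "1 \<le> h"
  shows "(real h) ^ 3 / 3 \<le> (\<Sum>i<n. (tent h i)\<^sup>2)"
proof -
  \<comment> \<open>Only the rising flank up to \<open>h\<close> is counted; it already gives the
    order \<open>h\<^sup>3\<close>.\<close>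
  have "(real m) ^ 3 / 3 \<le> (\<Sum>i\<le>m. (real i)\<^sup>2)" for m
    by (induction m) (auto simp: power2_eq_square power3_eq_cube algebra_simps)
  also have "(\<Sum>i\<le>h. (real i)\<^sup>2) = (\<Sum>i\<le>h. (tent h i)\<^sup>2)" by (simp add: tent_def)
  also have "\<dots> \<le> (\<Sum>i<n. (tent h i)\<^sup>2)" using assms by (intro sum_mono2) auto
  finally show ?thesis .
qed

context cycle_dynamics
begin

lemma tent_nx_slope:
  assumes "i < n" "4 * h \<le> n"
  shows "\<bar>tent h (nx i) - tent h i\<bar> \<le> 1"
proof (cases "Suc i = n")
  case True
  \<comment> \<open>On the closing edge \<open>nx i = 0\<close>; the tent vanishes there as it does
    at \<open>n\<close>, so the bound for \<open>Suc i\<close> carries over.\<close>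
  have "\<bar>tent h (Suc i) - tent h i\<bar> \<le> 1" by (rule tent_slope)
  moreover have "tent h (Suc i) = 0" using True assms by (intro tent_beyond) simp
  moreover have "tent h 0 = 0" by (simp add: tent_def)
  ultimately show ?thesis using True assms by (simp add: nx_eq)
next
  case False
  then show ?thesis using assms tent_slope by (simp add: nx_eq)
qed

lemma tent_variation_le:
  assumes "4 * h \<le> n"
  shows "(\<Sum>i<n. \<bar>tent h (nx i) - tent h i\<bar>) \<le> 4 * real h"
proof -
  have "(\<Sum>i<n. \<bar>tent h (nx i) - tent h i\<bar>) = (\<Sum>i<4 * h. \<bar>tent h (nx i) - tent h i\<bar>)"
    by (rule sum_tent_support[OF assms]) (auto simp: nx_eq tent_beyond, simp_all add: tent_def)
  also have "\<dots> \<le> (\<Sum>i<4 * h. 1)" using tent_nx_slope[OF _ assms] assms by (intro sum_mono) auto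
  finally show ?thesis by simp
qed

section \<open>The observable pairing the loads with a weight\<close>

definition pairing :: "(nat \<Rightarrow> real) \<Rightarrow> (nat \<Rightarrow> int) \<Rightarrow> real" where
  "pairing \<phi> x = (\<Sum>v<n. \<phi> v * of_int (x v))"

lemma pairing_add_ball:
  assumes "v < n"
  shows "pairing \<phi> (add_ball v x) = pairing \<phi> x + \<phi> v"
proof -
  have "pairing \<phi> (add_ball v x) = (\<Sum>u<n. \<phi> u * of_int (x u) + (if u = v then \<phi> u else 0))"
    unfolding pairing_def by (intro sum.cong refl) (auto simp: add_ball_apply algebra_simps)
  also have "\<dots> = pairing \<phi> x + \<phi> v" using assms by (simp add: sum.distrib pairing_def)
  finally show ?thesis .
qed

text \<open>As the weights sum to zero, the minimal load may be subtracted from every load; what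
  remains lies between 0 and the gap.\<close>

lemma pairing_le_Gap:
  assumes "(\<Sum>i<n. \<phi> i) = 0"
  shows "\<bar>pairing \<phi> x\<bar> \<le> (\<Sum>i<n. \<bar>\<phi> i\<bar>) * of_int (Gap (cycle_vertices n) x)"
proof -
  define a where "a = Min (x ` {..<n})"
  have "pairing \<phi> x = (\<Sum>v<n. \<phi> v * of_int (x v)) - (\<Sum>v<n. \<phi> v) * of_int a"
    by (simp add: pairing_def assms)
  also have "\<dots> = (\<Sum>v<n. \<phi> v * of_int (x v - a))"
    by (simp add: sum_distrib_left sum_subtractf algebra_simps)
  finally have "\<bar>pairing \<phi> x\<bar> \<le> (\<Sum>v<n. \<bar>\<phi> v * of_int (x v - a)\<bar>)" by simp
  also have "\<dots> \<le> (\<Sum>v<n. \<bar>\<phi> v\<bar> * of_int (Gap (cycle_vertices n) x))"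
  proof (rule sum_mono)
    fix v assume "v \<in> {..<n}"
    then have "a \<le> x v" "x v \<le> Max (x ` {..<n})" by (auto simp: a_def)
    then have "\<bar>real_of_int (x v - a)\<bar> \<le> of_int (Gap (cycle_vertices n) x)"
      by (simp add: Gap_def cycle_vertices_def a_def)
    then show "\<bar>\<phi> v * of_int (x v - a)\<bar> \<le> \<bar>\<phi> v\<bar> * of_int (Gap (cycle_vertices n) x)"
      unfolding abs_mult by (intro mult_left_mono) auto
  qed
  finally show ?thesis by (simp add: sum_distrib_right)
qed

text \<open>If edge \<open>i\<close> always served vertex \<open>i\<close>, the pairing would move
  by \<open>\<phi> i\<close>, giving the terms \<open>\<phi> i * D i\<close>. By the unit slope, the
  actual choice of the end changes each \<open>ev i\<close> by at most 1, at total cost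
  \<open>\<Sum>i<n. \<bar>\<phi> i\<bar>\<close>. Within \<open>c - h\<close> the cutoff does not
  act and \<open>D i = \<phi> i\<close>.\<close>

lemma wev_cutoff_pairing_ge:
  assumes zero: "(\<Sum>i<n. \<phi> i) = 0"
    and h: "\<And>i. i < n \<Longrightarrow> \<bar>\<phi> i\<bar> \<le> h"
    and slope: "\<And>i. i < n \<Longrightarrow> \<bar>\<phi> (nx i) - \<phi> i\<bar> \<le> 1"
  shows "(if \<bar>pairing \<phi> x\<bar> \<le> c - h then \<Sum>i<n. (\<phi> i)\<^sup>2 else 0) - (\<Sum>i<n. \<bar>\<phi> i\<bar>)
    \<le> wev \<phi> (\<lambda>x. cutoff c (pairing \<phi> x)) x"
proof -
  define z where "z = pairing \<phi> x"
  define f where "f x = cutoff c (pairing \<phi> x)" for x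
  define D where "D i = cutoff c (z + \<phi> i) - cutoff c z" for i
  have ev_ge: "\<phi> i * D i - \<bar>\<phi> i\<bar> \<le> \<phi> i * (ev i f x - cutoff c z)" if i: "i < n" for i
  proof -
    define r where "r = q i (x i - x (nx i))"
    have r: "0 \<le> r" "r \<le> 1" using q_nonneg q_le_1 i by (auto simp: r_def)
    have eq: "ev i f x - cutoff c z = D i + (1 - r) * (cutoff c (z + \<phi> (nx i)) - cutoff c (z + \<phi> i))"
      using i by (simp add: ev_def f_def pairing_add_ball D_def r_def z_def algebra_simps)
    have "\<bar>cutoff c (z + \<phi> (nx i)) - cutoff c (z + \<phi> i)\<bar> \<le> 1"
      using cutoff_lipschitz[of c "z + \<phi> (nx i)" "z + \<phi> i"] slope[OF i] by simp
    then have "\<bar>(1 - r) * (cutoff c (z + \<phi> (nx i)) - cutoff c (z + \<phi> i))\<bar> \<le> 1"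
      unfolding abs_mult using r by (intro mult_le_one) auto
    then have "\<bar>\<phi> i * ((1 - r) * (cutoff c (z + \<phi> (nx i)) - cutoff c (z + \<phi> i)))\<bar> \<le> \<bar>\<phi> i\<bar> * 1"
      unfolding abs_mult[of "\<phi> i"] by (intro mult_left_mono) auto
    then show ?thesis unfolding eq by (simp add: algebra_simps abs_le_iff)
  qed
  have "(if \<bar>z\<bar> \<le> c - h then \<Sum>i<n. (\<phi> i)\<^sup>2 else 0) \<le> (\<Sum>i<n. \<phi> i * D i)"
  proof (cases "\<bar>z\<bar> \<le> c - h")
    case True
    have "D i = \<phi> i" if "i < n" for i
    proof -
      have "cutoff c (z + \<phi> i) = z + \<phi> i" "cutoff c z = z"
        using True h[OF that] by (auto intro!: cutoff_id)
      then show ?thesis by (simp add: D_def)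
    qed
    then show ?thesis using True by (simp add: power2_eq_square)
  next
    case False
    then show ?thesis by (auto simp: D_def intro!: sum_nonneg mult_cutoff_diff_nonneg)
  qed
  then have "(if \<bar>z\<bar> \<le> c - h then \<Sum>i<n. (\<phi> i)\<^sup>2 else 0) - (\<Sum>i<n. \<bar>\<phi> i\<bar>) \<le> (\<Sum>i<n. \<phi> i * D i - \<bar>\<phi> i\<bar>)"
    by (simp add: sum_subtractf)
  also have "\<dots> \<le> (\<Sum>i<n. \<phi> i * (ev i f x - cutoff c z))" using ev_ge by (intro sum_mono) auto
  \<comment> \<open>Subtracting the constant \<open>cutoff c z\<close> is free because the weights
    sum to zero.\<close>
  also have "\<dots> = wev \<phi> f x - (\<Sum>i<n. \<phi> i) * cutoff c z"
    by (simp add: wev_def sum_distrib_left sum_subtractf algebra_simps)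
  finally show ?thesis unfolding zero z_def f_def[abs_def] by simp
qed

text \<open>An integer gap below 1 means that all loads agree, and at most one vertex can level a
  given profile with one ball. That vertex lies on two edges, each drawn with probability
  \<open>1 / n\<close>.\<close>

lemma step_flat_le:
  defines "f \<equiv> \<lambda>x. of_bool (Gap (cycle_vertices n) x < 1)"
  shows "step f x \<le> 2 / n"
proof -
  have f01: "0 \<le> f y" for y by (simp add: f_def)
  have const: "y u = y v" if "Gap (cycle_vertices n) y < 1" "u < n" "v < n" for y u v
  proof -
    have "Min (y ` {..<n}) \<le> y u" "y u \<le> Max (y ` {..<n})" "Min (y ` {..<n}) \<le> y v" "y v \<le> Max (y ` {..<n})"
      using that by auto
    then show ?thesis using that(1) by (simp add: Gap_def cycle_vertices_def)
  qed
  have one: "(\<Sum>v<n. f (add_ball v x)) \<le> 1"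
  proof -
    have uniq: "u = v" if "u < n" "v < n" "Gap (cycle_vertices n) (add_ball u x) < 1"
      "Gap (cycle_vertices n) (add_ball v x) < 1" for u v
    proof (rule ccontr)
      assume "u \<noteq> v"
      then have "add_ball u x u = x u + 1" "add_ball u x v = x v" "add_ball v x u = x u" "add_ball v x v = x v + 1"
        by (simp_all add: add_ball_apply)
      then show False using const[OF that(3,1,2)] const[OF that(4,1,2)] by linarith
    qed
    have "(\<Sum>v<n. f (add_ball v x)) = card {v\<in>{..<n}. Gap (cycle_vertices n) (add_ball v x) < 1}"
      by (simp add: f_def of_bool_def sum.If_cases Int_def)
    moreover have "card {v\<in>{..<n}. Gap (cycle_vertices n) (add_ball v x) < 1} \<le> Suc 0"
      by (subst card_le_Suc0_iff_eq) (auto intro: uniq)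
    ultimately show ?thesis by simp
  qed
  have "ev i f x \<le> f (add_ball i x) + f (add_ball (nx i) x)" if "i < n" for i
    unfolding ev_def using q_nonneg[OF that] q_le_1[OF that] f01
    by (intro add_mono mult_left_le_one_le) auto
  then have "(\<Sum>i<n. ev i f x) \<le> (\<Sum>i<n. f (add_ball i x) + f (add_ball (nx i) x))"
    by (intro sum_mono) auto
  also have "\<dots> = 2 * (\<Sum>v<n. f (add_ball v x))"
    using sum_nx[of "\<lambda>v. f (add_ball v x)"] by (simp add: sum.distrib)
  also have "\<dots> \<le> 2" using one by simp
  finally show ?thesis unfolding step_def by (rule divide_right_mono) simp
qed

end

context cycle_process
begin

lemma pred_profile [measurable]: "Measurable.pred M (\<lambda>\<omega>. P (X m \<omega>))"
proof -
  have "Measurable.pred M (\<lambda>\<omega>. (of_bool (P (X m \<omega>)) :: real) > 0)"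
    using comp_profile_measurable[of "\<lambda>x. of_bool (P x)" m] by measurable
  then show ?thesis by simp
qed

text \<open>Between the two sides stands the correlation of \<open>f (X k)\<close> with the weights
  of the last \<open>n * t\<close> events: below it the summed main terms minus the commutator
  costs, above it the inequality of the means.\<close>

lemma correlation_inequality:
  fixes \<phi> :: "nat \<Rightarrow> real" and c h :: real
  assumes zero: "(\<Sum>i<n. \<phi> i) = 0"
    and h: "\<And>i. i < n \<Longrightarrow> \<bar>\<phi> i\<bar> \<le> h"
    and slope: "\<And>i. i < n \<Longrightarrow> \<bar>\<phi> (nx i) - \<phi> i\<bar> \<le> 1"
    and k: "n * t \<le> k" "1 \<le> k" and c: "0 \<le> c"
  defines "S \<equiv> \<Sum>i<n. (\<phi> i)\<^sup>2" and "A \<equiv> \<Sum>i<n. \<bar>\<phi> i\<bar>" and "T \<equiv> \<Sum>i<n. \<bar>\<phi> (nx i) - \<phi> i\<bar>"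
  shows "t * (S * prob {\<omega> \<in> space M. \<bar>pairing \<phi> (X (k - 1) \<omega>)\<bar> \<le> c - h} - A) - 2 * T * t\<^sup>2
    \<le> 4 * c\<^sup>2 + t * S / 16"
proof -
  define f where "f x = cutoff c (pairing \<phi> x)" for x
  define E0 where "E0 = expectation (\<lambda>\<omega>. wev \<phi> f (X (k - 1) \<omega>))"
  define I where "I = {k - n * t..<k}"
  define G where "G = {\<omega> \<in> space M. \<bar>pairing \<phi> (X (k - 1) \<omega>)\<bar> \<le> c - h}"
  have G: "G \<in> events" unfolding G_def by measurable
  have n0: "0 < real n" using n_ge_3 by simp
  have h0: "0 \<le> h" using h[of 0] n_ge_3 by auto
  have fb: "\<bar>f x\<bar> \<le> c" for x unfolding f_def using c by (rule cutoff_abs_le)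
  have grad: "\<bar>f (add_ball (nx j) x) - f (add_ball j x)\<bar> \<le> \<bar>\<phi> (nx j) - \<phi> j\<bar>" if "j < n" for x j
    using cutoff_lipschitz[of c "pairing \<phi> x + \<phi> (nx j)" "pairing \<phi> x + \<phi> j"] that
    by (simp add: f_def pairing_add_ball)
  have cardI: "card I = n * t" "finite I" using k by (auto simp: I_def)
  have wint: "integrable M (\<lambda>\<omega>. weight \<phi> s \<omega> * f (X k \<omega>))" for s
  proof (rule integrable_bounded)
    show "(\<lambda>\<omega>. weight \<phi> s \<omega> * f (X k \<omega>)) \<in> borel_measurable M"
      using weight_measurable comp_profile_measurable by (rule borel_measurable_times)
    show "\<bar>weight \<phi> s \<omega> * f (X k \<omega>)\<bar> \<le> h * c" for \<omega>
      unfolding abs_mult using weight_abs_le[OF h h0] fb h0 by (intro mult_mono) auto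
  qed
  have "S * prob G - A = expectation (\<lambda>\<omega>. S * indicator G \<omega> - A)"
    using G by (simp add: emeasure_eq_measure prob_space)
  also have "\<dots> \<le> E0" unfolding E0_def
  proof (rule integral_mono)
    show "integrable M (\<lambda>\<omega>. S * indicator G \<omega> - A)" using G by (simp add: emeasure_eq_measure)
    show "integrable M (\<lambda>\<omega>. wev \<phi> f (X (k - 1) \<omega>))"
      by (rule integrable_bounded[OF comp_profile_measurable wev_abs_le[OF h fb]])
    show "S * indicator G \<omega> - A \<le> wev \<phi> f (X (k - 1) \<omega>)" if "\<omega> \<in> space M" for \<omega>
      using wev_cutoff_pairing_ge[where c=c and x="X (k - 1) \<omega>", OF zero h slope] that
      by (simp add: f_def[abs_def] G_def S_def A_def indicator_def split: if_splits)
  qed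
  finally have E0: "S * prob G - A \<le> E0" .
  \<comment> \<open>At most \<open>n * t\<close> events follow event \<open>s\<close>, which bounds
    its commutator cost; \<open>E0\<close> is the same for all \<open>s\<close>.\<close>
  have low: "E0 / n - t * (2 * T / n) \<le> expectation (\<lambda>\<omega>. weight \<phi> s \<omega> * f (X k \<omega>))" if s: "s \<in> I" for s
  proof -
    define r where "r = k - 1 - s"
    have r: "Suc (s + r) = k" "s + r = k - 1" "r \<le> n * t" using s k by (auto simp: r_def I_def)
    have T0: "0 \<le> T" unfolding T_def by (rule sum_nonneg) simp
    have "\<bar>expectation (\<lambda>\<omega>. weight \<phi> s \<omega> * f (X k \<omega>)) - E0 / n\<bar> \<le> r * (2 * T / n) / n"
      using expectation_weight_profile[where f=f and \<phi>=\<phi> and w="\<lambda>j. \<bar>\<phi> (nx j) - \<phi> j\<bar>" and s=s and r=r,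
          OF fb grad h slope, unfolded r(1), unfolded r(2)]
      unfolding E0_def T_def .
    also have "r * (2 * T / n) / n \<le> real (n * t) * (2 * T / n) / n"
      using r(3) T0 n0 by (intro divide_right_mono mult_right_mono) (simp_all only: of_nat_le_iff, auto)
    also have "\<dots> = t * (2 * T / n)" using n0 by simp
    finally show ?thesis by linarith
  qed
  have "t * E0 - 2 * T * (real t)\<^sup>2 = (\<Sum>s\<in>I. E0 / n - t * (2 * T / n))"
    using n0 cardI by (simp add: field_simps power2_eq_square)
  also have "\<dots> \<le> (\<Sum>s\<in>I. expectation (\<lambda>\<omega>. weight \<phi> s \<omega> * f (X k \<omega>)))"
    using low by (rule sum_mono)
  also have "\<dots> = expectation (\<lambda>\<omega>. (\<Sum>s\<in>I. weight \<phi> s \<omega>) * f (X k \<omega>))"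
    using wint by (simp add: sum_distrib_right)
  \<comment> \<open>From \<open>u * v \<le> 4 * v\<^sup>2 + u\<^sup>2 / 16\<close>; the factor 1/16
    keeps the martingale term \<open>t * S / 16\<close> small beside \<open>t * S\<close>.\<close>
  also have "\<dots> \<le> expectation (\<lambda>\<omega>. 4 * c\<^sup>2 + (\<Sum>s\<in>I. weight \<phi> s \<omega>)\<^sup>2 / 16)"
  proof (rule integral_mono)
    show "integrable M (\<lambda>\<omega>. (\<Sum>s\<in>I. weight \<phi> s \<omega>) * f (X k \<omega>))"
      using wint by (simp add: sum_distrib_right)
    show "integrable M (\<lambda>\<omega>. 4 * c\<^sup>2 + (\<Sum>s\<in>I. weight \<phi> s \<omega>)\<^sup>2 / 16)"
      using weight_sum_second_moment(1)[OF zero cardI(2)] by simp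
    show "(\<Sum>s\<in>I. weight \<phi> s \<omega>) * f (X k \<omega>) \<le> 4 * c\<^sup>2 + (\<Sum>s\<in>I. weight \<phi> s \<omega>)\<^sup>2 / 16" for \<omega>
    proof -
      have "(f (X k \<omega>))\<^sup>2 \<le> c\<^sup>2" using fb c by (metis abs_le_square_iff abs_of_nonneg)
      moreover have "0 \<le> (2 * f (X k \<omega>) - (\<Sum>s\<in>I. weight \<phi> s \<omega>) / 4)\<^sup>2" by simp
      ultimately show ?thesis by (simp add: power2_eq_square algebra_simps)
    qed
  qed
  also have "\<dots> = 4 * c\<^sup>2 + t * S / 16"
    using weight_sum_second_moment[OF zero cardI(2)] n0
    by (simp add: prob_space cardI(1) S_def)
  finally have "t * E0 - 2 * T * (real t)\<^sup>2 \<le> 4 * c\<^sup>2 + t * S / 16" .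
  moreover have "t * (S * prob G - A) \<le> t * E0" using E0 by (intro mult_left_mono) auto
  ultimately show ?thesis unfolding G_def by linarith
qed

end

section \<open>The lower bound on the gap\<close>

text \<open>After division by \<open>t\<close> all terms are compared with \<open>h\<^sup>3\<close>.
  Here \<open>(7/8 - 1/16) * S\<close> is at least \<open>13 * h\<^sup>3 / 48\<close>, and
  \<open>t\<close> near \<open>h\<^sup>2 / 64\<close> keeps \<open>2 * T * t\<close> at most
  \<open>h\<^sup>3 / 8\<close>. The terms from \<open>c\<close> and \<open>A\<close> are negligible
  owing to the 8192 and to the size of \<open>h\<close>.\<close>

lemma gap_numerics:
  fixes h t g S A T P c :: real
  assumes h: "h \<ge> 1000000" and t: "h\<^sup>2 / 64 - 1 \<le> t" "t \<le> h\<^sup>2 / 64"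
    and g: "0 \<le> g" "g\<^sup>2 \<le> 5 * h / 8192\<^sup>2"
    and S: "h ^ 3 / 3 \<le> S" and A: "0 \<le> A" "A \<le> 4 * h\<^sup>2" and T: "T \<le> 4 * h" and P: "7 / 8 \<le> P"
    and c: "c = A * g + 2 * h"
  shows "4 * c\<^sup>2 + t * S / 16 < t * (S * P - A) - 2 * T * t\<^sup>2"
proof -
  have h2: "1000000 * h \<le> h\<^sup>2" using h by (simp add: power2_eq_square)
  have h3: "1000000 * h\<^sup>2 \<le> h ^ 3" using h by (simp add: power2_eq_square power3_eq_cube)
  \<comment> \<open>The rounding of \<open>t\<close> is absorbed by passing from 64 to 65.\<close>
  have t65: "h\<^sup>2 / 65 \<le> t" using t h2 h by simp
  have t0: "0 < t" using t65 h by (smt (verit) divide_pos_pos zero_less_power)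
  have h0: "0 \<le> h" using h by linarith
  have c0: "0 \<le> c" unfolding c by (simp add: A g h0)
  have "c \<le> 4 * h\<^sup>2 * g + 2 * h" unfolding c using mult_right_mono[OF A(2) g(1)] by simp
  then have "c\<^sup>2 \<le> (4 * h\<^sup>2 * g + 2 * h)\<^sup>2" using c0 by (rule power_mono)
  also have "\<dots> \<le> 2 * (4 * h\<^sup>2 * g)\<^sup>2 + 2 * (2 * h)\<^sup>2"
    using zero_le_power2[of "4 * h\<^sup>2 * g - 2 * h"] by (simp add: power2_eq_square algebra_simps)
  also have "\<dots> = h\<^sup>2 * (32 * h\<^sup>2 * g\<^sup>2 + 8)" by (simp add: power2_eq_square algebra_simps)
  also have "\<dots> \<le> (65 * t) * (160 * h ^ 3 / 8192\<^sup>2 + 8)"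
  proof (rule mult_mono)
    have "32 * h\<^sup>2 * g\<^sup>2 \<le> 32 * h\<^sup>2 * (5 * h / 8192\<^sup>2)" using g by (intro mult_left_mono) auto
    also have "\<dots> = 160 * h ^ 3 / 8192\<^sup>2" by (simp add: power2_eq_square power3_eq_cube)
    finally show "32 * h\<^sup>2 * g\<^sup>2 + 8 \<le> 160 * h ^ 3 / 8192\<^sup>2 + 8" by simp
  qed (use t65 h t0 in auto)
  finally have c2: "c\<^sup>2 \<le> t * (65 * (160 * h ^ 3 / 8192\<^sup>2 + 8))" by (simp add: algebra_simps)
  have S0: "0 \<le> S" using S h by (smt (verit) divide_nonneg_nonneg zero_le_power)
  have K: "260 * (160 * h ^ 3 / 8192\<^sup>2 + 8) = 325 * h ^ 3 / 524288 + 2080"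
    by (simp add: power2_eq_square[of 8192])
  have "S * (7 / 8) \<le> S * P" using P S0 by (rule mult_left_mono)
  moreover have "2 * T * t \<le> 2 * (4 * h) * (h\<^sup>2 / 64)"
  proof -
    have "2 * T * t \<le> 2 * (4 * h) * t" using T t0 by (intro mult_right_mono) auto
    also have "\<dots> \<le> 2 * (4 * h) * (h\<^sup>2 / 64)" using t h0 by (intro mult_left_mono) auto
    finally show ?thesis .
  qed
  then have "2 * T * t \<le> h ^ 3 / 8" by (simp add: power2_eq_square power3_eq_cube)
  ultimately have "260 * (160 * h ^ 3 / 8192\<^sup>2 + 8) + S / 16 < S * P - A - 2 * T * t"
    unfolding K using S A h3 h2 h by linarith
  then have "t * (260 * (160 * h ^ 3 / 8192\<^sup>2 + 8) + S / 16) < t * (S * P - A - 2 * T * t)"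
    using t0 by (rule mult_strict_left_mono)
  then show ?thesis using c2 by (simp add: algebra_simps power2_eq_square)
qed

context cycle_process
begin

text \<open>Otherwise the gap is below \<open>g\<close> with probability at least 7/8, which
  confines the pairing, and the correlation inequality contradicts
  \<open>gap_numerics\<close>.\<close>

lemma prob_Gap_ge:
  fixes g :: real
  assumes h: "h \<ge> 1000000" "4 * h \<le> n" and k: "n * (h\<^sup>2 div 64) \<le> k" "1 \<le> k"
    and g: "0 \<le> g" "g\<^sup>2 \<le> 5 * h / 8192\<^sup>2"
  shows "prob {\<omega> \<in> space M. g \<le> real_of_int (Gap (cycle_vertices n) (X k \<omega>))} \<ge> 1 / 8"
proof (rule ccontr)
  let ?G = "\<lambda>m \<omega>. real_of_int (Gap (cycle_vertices n) (X m \<omega>))"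
  define t where "t = h\<^sup>2 div 64"
  define S where "S = (\<Sum>i<n. (tent h i)\<^sup>2)"
  define A where "A = (\<Sum>i<n. \<bar>tent h i\<bar>)"
  define T where "T = (\<Sum>i<n. \<bar>tent h (nx i) - tent h i\<bar>)"
  \<comment> \<open>A gap below \<open>g\<close> bounds the pairing at time \<open>k\<close> by
    \<open>A * g\<close>. One \<open>h\<close> allows for the step back to time
    \<open>k - 1\<close>, the other is headroom below the cutoff.\<close>
  define c where "c = A * g + 2 * h"
  define P where "P = prob {\<omega> \<in> space M. \<bar>pairing (tent h) (X (k - 1) \<omega>)\<bar> \<le> c - h}"
  assume "\<not> prob {\<omega> \<in> space M. g \<le> ?G k \<omega>} \<ge> 1 / 8"
  moreover have "{\<omega> \<in> space M. g \<le> ?G k \<omega>} \<in> events"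
    using pred_profile[of "\<lambda>x. g \<le> real_of_int (Gap (cycle_vertices n) x)" k] by measurable
  moreover have "space M - {\<omega> \<in> space M. g \<le> ?G k \<omega>} = {\<omega> \<in> space M. ?G k \<omega> < g}" by auto
  ultimately have P1: "7 / 8 \<le> prob {\<omega> \<in> space M. ?G k \<omega> < g}"
    using prob_compl[of "{\<omega> \<in> space M. g \<le> ?G k \<omega>}"] by simp
  have A0: "0 \<le> A" unfolding A_def by (rule sum_nonneg) simp
  have zero: "(\<Sum>i<n. tent h i) = 0" by (rule sum_tent[OF h(2)])
  have kS: "k = Suc (k - 1)" using k by simp
  have "{\<omega> \<in> space M. ?G k \<omega> < g} \<subseteq> {\<omega> \<in> space M. \<bar>pairing (tent h) (X (k - 1) \<omega>)\<bar> \<le> c - h}"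
  proof safe
    fix \<omega> assume w: "\<omega> \<in> space M" "?G k \<omega> < g"
    have "\<bar>pairing (tent h) (X k \<omega>)\<bar> \<le> A * ?G k \<omega>" unfolding A_def by (rule pairing_le_Gap[OF zero])
    also have "\<dots> \<le> A * g" using w A0 by (intro mult_left_mono) auto
    finally have 1: "\<bar>pairing (tent h) (X k \<omega>)\<bar> \<le> A * g" .
    have "edge (k - 1) \<omega> \<in> cycle_edges n" using measurable_space[OF edge_measurable w(1)] by simp
    then have uv: "fst (ori (edge (k - 1) \<omega>)) < n" "snd (ori (edge (k - 1) \<omega>)) < n"
      using ori_in_V by (auto simp: cycle_vertices_def)
    have "X k \<omega> = allocate ori p (edge (k - 1) \<omega>) (mark (k - 1) \<omega>) (X (k - 1) \<omega>)"
      using profile.simps(2)[of ori p X0 edge mark "k - 1" \<omega>] unfolding kS[symmetric] .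
    then have "\<bar>pairing (tent h) (X k \<omega>) - pairing (tent h) (X (k - 1) \<omega>)\<bar> \<le> h"
      using uv tent_abs_le by (simp add: allocate_eq pairing_add_ball)
    then show "\<bar>pairing (tent h) (X (k - 1) \<omega>)\<bar> \<le> c - h" using 1 unfolding c_def by linarith
  qed
  moreover have "{\<omega> \<in> space M. \<bar>pairing (tent h) (X (k - 1) \<omega>)\<bar> \<le> c - h} \<in> events"
    using pred_profile[of "\<lambda>x. \<bar>pairing (tent h) x\<bar> \<le> c - h" "k - 1"] by measurable
  ultimately have P78: "7 / 8 \<le> P" unfolding P_def by (intro order_trans[OF P1] finite_measure_mono)
  have "4 * c\<^sup>2 + real t * S / 16 < t * (S * P - A) - 2 * T * (real t)\<^sup>2"
  proof (rule gap_numerics[where h="real h" and g=g])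
    have "real (h\<^sup>2) = 64 * real t + real (h\<^sup>2 mod 64)"
      unfolding t_def by (metis of_nat_add of_nat_mult of_nat_numeral mult_div_mod_eq)
    moreover have "real (h\<^sup>2 mod 64) \<le> 64" by (simp add: less_imp_le)
    moreover have "0 \<le> real (h\<^sup>2 mod 64)" by simp
    ultimately show "(real h)\<^sup>2 / 64 - 1 \<le> real t" "real t \<le> (real h)\<^sup>2 / 64"
      unfolding of_nat_power by linarith+
    show "real h ^ 3 / 3 \<le> S" unfolding S_def using h by (intro sum_squares_tent_ge) auto
    show "A \<le> 4 * (real h)\<^sup>2" unfolding A_def by (rule sum_abs_tent_le[OF h(2)])
    show "T \<le> 4 * real h" unfolding T_def by (rule tent_variation_le[OF h(2)])
  qed (use h g A0 c_def P78 in simp_all)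
  moreover have "t * (S * P - A) - 2 * T * (real t)\<^sup>2 \<le> 4 * c\<^sup>2 + t * S / 16"
    unfolding S_def P_def A_def T_def
    by (rule correlation_inequality[OF zero tent_abs_le tent_nx_slope[OF _ h(2)] k[folded t_def]])
      (use A0 g h in \<open>auto simp: c_def\<close>)
  ultimately show False by linarith
qed

text \<open>This serves thresholds up to 1: whatever the profile before the last event, it becomes
  flat with probability at most \<open>2 / n\<close>.\<close>

lemma prob_not_flat:
  assumes "1 \<le> k"
  shows "prob {\<omega> \<in> space M. 1 \<le> Gap (cycle_vertices n) (X k \<omega>)} \<ge> 1 / 3"
proof -
  define f :: "(nat \<Rightarrow> int) \<Rightarrow> real" where "f x = of_bool (Gap (cycle_vertices n) x < 1)" for x
  define m where "m = k - 1"
  have k: "k = m + 1" using assms by (simp add: m_def)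
  define B where "B = {\<omega> \<in> space M. Gap (cycle_vertices n) (X k \<omega>) < 1}"
  have B: "B \<in> events" unfolding B_def by measurable
  have "prob B = expectation (\<lambda>\<omega>. 1 * f (X (m + 1) \<omega>))"
  proof -
    have "prob B = expectation (indicator B)" using B by simp
    also have "\<dots> = expectation (\<lambda>\<omega>. 1 * f (X (m + 1) \<omega>))"
      by (rule Bochner_Integration.integral_cong[OF refl]) (simp only: B_def k f_def indicator_def of_bool_def, simp)
    finally show ?thesis .
  qed
  also have "\<dots> = expectation (\<lambda>\<omega>. 1 * (step ^^ 1) f (X m \<omega>))"
    by (rule expectation_step_pow[where B=1 and K=1]) (auto simp: f_def)
  also have "\<dots> \<le> expectation (\<lambda>\<omega>. 2 / n)"
  proof (rule integral_mono)
    have "\<bar>step f x\<bar> \<le> 1" for x by (rule step_abs_le) (simp add: f_def)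
    then show "integrable M (\<lambda>\<omega>. 1 * (step ^^ 1) f (X m \<omega>))"
      using comp_profile_measurable[of "step f" m] by (intro integrable_bounded[where B=1]) simp_all
    show "1 * (step ^^ 1) f (X m \<omega>) \<le> 2 / n" for \<omega>
      using step_flat_le[of "X m \<omega>"] by (simp add: f_def[abs_def])
  qed simp
  also have "\<dots> \<le> 2 / 3" using n_ge_3 by (simp add: prob_space field_simps)
  finally have "prob B \<le> 2 / 3" .
  moreover have "prob (space M - B) = 1 - prob B" using B by (rule prob_compl)
  moreover have "space M - B = {\<omega> \<in> space M. 1 \<le> Gap (cycle_vertices n) (X k \<omega>)}"
    by (auto simp: B_def)
  ultimately show ?thesis by simp
qed

lemma prob_Gap_ge_min:
  assumes k: "1 \<le> k"
  shows "prob {\<omega> \<in> space M. min (sqrt n) ((k / n) powr (1/4)) / (2048 * (pi * sqrt 3))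
     \<le> real_of_int (Gap (cycle_vertices n) (X k \<omega>))} \<ge> 1 / 8"
proof -
  define H where "H = min (sqrt n) ((k / n) powr (1/4))"
  define g where "g = H / (2048 * (pi * sqrt 3))"
  have n0: "0 < real n" using n_ge_3 by simp
  have H0: "0 \<le> H" by (simp add: H_def)
  \<comment> \<open>From \<open>pi > 3\<close> and \<open>sqrt 3 \<ge> 4 / 3\<close>, the product is
    at least 4, so \<open>g\<close> is at most \<open>H / 8192\<close>.\<close>
  have "3 * (4 / 3) \<le> pi * sqrt 3"
    using pi_gt3 by (intro mult_mono real_le_rsqrt) (auto simp: power2_eq_square)
  then have D: "8192 \<le> 2048 * (pi * sqrt 3)" by simp
  have g0: "0 \<le> g" unfolding g_def using H0 D by (intro divide_nonneg_nonneg) auto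
  have g1: "g \<le> H / 8192" unfolding g_def using H0 D by (intro divide_left_mono) auto
  have "H\<^sup>2 \<le> (sqrt n)\<^sup>2" using H0 by (intro power_mono) (simp_all add: H_def)
  then have H2: "H\<^sup>2 \<le> n" by simp
  have "H ^ 4 \<le> ((k / n) powr (1/4)) ^ 4" using H0 by (intro power_mono) (simp_all add: H_def)
  also have "\<dots> = k / n" using k n0 by (simp add: powr_power)
  finally have H4: "H ^ 4 \<le> k / n" .
  have "prob {\<omega> \<in> space M. g \<le> real_of_int (Gap (cycle_vertices n) (X k \<omega>))} \<ge> 1 / 8"
  \<comment> \<open>A threshold up to 1 is met whenever the gap is nonzero; otherwise
    \<open>H\<close> is large enough for the tent argument.\<close>
  proof (cases "g \<le> 1")
    case True
    have "1 / 3 \<le> prob {\<omega> \<in> space M. 1 \<le> Gap (cycle_vertices n) (X k \<omega>)}" by (rule prob_not_flat[OF k])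
    also have "\<dots> \<le> prob {\<omega> \<in> space M. g \<le> real_of_int (Gap (cycle_vertices n) (X k \<omega>))}"
    proof (rule finite_measure_mono)
      show "{\<omega> \<in> space M. g \<le> real_of_int (Gap (cycle_vertices n) (X k \<omega>))} \<in> events"
        using pred_profile[of "\<lambda>x. g \<le> real_of_int (Gap (cycle_vertices n) x)" k] by measurable
    qed (use True in auto)
    finally show ?thesis by simp
  next
    case False
    then have H8: "8192 \<le> H" using g1 by simp
    \<comment> \<open>About \<open>H\<^sup>2 / 4\<close>: then \<open>H\<^sup>2 \<le> n\<close>
      makes the tent fit into the cycle, and \<open>H ^ 4 \<le> k / n\<close> leaves room for the
      window of events.\<close>
    define h where "h = nat \<lfloor>H\<^sup>2 / 4\<rfloor>"
    have h_le: "real h \<le> H\<^sup>2 / 4" unfolding h_def by (rule of_nat_floor) simp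
    have h_ge: "H\<^sup>2 / 4 - 1 \<le> real h" unfolding h_def by linarith
    have "8192 * 8192 \<le> H\<^sup>2" unfolding power2_eq_square using H8 by (intro mult_mono) auto
    then have h5: "H\<^sup>2 \<le> 5 * real h" and hbig: "real h \<ge> 1000000" using h_ge by linarith+
    show ?thesis
    proof (rule prob_Gap_ge[of h])
      show "1000000 \<le> h" using hbig by linarith
      show "4 * h \<le> n" using h_le H2 by linarith
      show "n * (h\<^sup>2 div 64) \<le> k"
      proof -
        have "h\<^sup>2 div 64 \<le> h\<^sup>2" by simp
        then have "real (h\<^sup>2 div 64) \<le> (real h)\<^sup>2" unfolding of_nat_power[symmetric] of_nat_le_iff .
        also have "\<dots> \<le> (H\<^sup>2)\<^sup>2" using h_le by (intro power_mono) (auto intro: order_trans)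
        also have "\<dots> = H ^ 4" by (simp flip: power_mult)
        finally have "real (h\<^sup>2 div 64) \<le> k / n" using H4 by linarith
        then have "real (n * (h\<^sup>2 div 64)) \<le> real k" using n0 by (simp add: field_simps)
        then show ?thesis by (simp only: of_nat_le_iff)
      qed
      have "g\<^sup>2 \<le> (H / 8192)\<^sup>2" using g1 g0 by (rule power_mono)
      then show "g\<^sup>2 \<le> 5 * real h / 8192\<^sup>2" using h5 by (simp add: power_divide)
    qed (use k g0 in auto)
  qed
  then show ?thesis unfolding g_def H_def .
qed

end

theorem theorem1p2:
  fixes c' :: real and n k :: nat and M :: "'a measure"
    and ori :: "nat set \<Rightarrow> nat \<times> nat" and p :: "nat set \<Rightarrow> int \<Rightarrow> real"
    and X0 :: "'a \<Rightarrow> nat \<Rightarrow> int"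
    and edge :: "nat \<Rightarrow> 'a \<Rightarrow> nat set" and mark :: "nat \<Rightarrow> 'a \<Rightarrow> real"
  assumes "c' = 1 / (16384 * pi * sqrt 3)"
    and "n \<ge> 3"
    and "allocation_process M (cycle_vertices n) (cycle_edges n) ori p X0 edge mark"
    and "k \<ge> 1"
  shows "c' > 0
    \<and> (\<integral>\<^sup>+\<omega>. ennreal (real_of_int (Gap (cycle_vertices n) (profile ori p X0 edge mark k \<omega>))) \<partial>M)
        \<ge> ennreal (c' * min (sqrt (real n)) ((real k / real n) powr (1/4)))
    \<and> measure M {\<omega> \<in> space M. real_of_int (Gap (cycle_vertices n) (profile ori p X0 edge mark k \<omega>))
          \<ge> c' * min (sqrt (real n)) ((real k / real n) powr (1/4))} \<ge> 1 / 8"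
proof -
  interpret P: cycle_process M n ori p X0 edge mark
    using assms(2,3) by (simp add: cycle_process_def cycle_process_axioms_def)
  define H where "H = min (sqrt (real n)) ((real k / real n) powr (1/4))"
  define G where "G \<omega> = real_of_int (Gap (cycle_vertices n) (profile ori p X0 edge mark k \<omega>))" for \<omega>
  \<comment> \<open>As \<open>16384 = 8 * 2048\<close>, the threshold of
    \<open>prob_Gap_ge_min\<close> is \<open>8 * (c' * H)\<close>; the factor 8 offsets the
    probability 1/8 in the bound of the expectation.\<close>
  define B where "B = {\<omega> \<in> space M. 8 * (c' * H) \<le> G \<omega>}"
  have c0: "c' > 0" using assms(1) by simp
  have H0: "0 \<le> H" by (simp add: H_def)
  have cH0: "0 \<le> c' * H" using c0 H0 by simp
  have g_eq: "8 * (c' * H) = H / (2048 * (pi * sqrt 3))" using assms(1) by simp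
  have B: "B \<in> P.events" unfolding B_def G_def
    using P.pred_profile[of "\<lambda>x. 8 * (c' * H) \<le> real_of_int (Gap (cycle_vertices n) x)" k] by measurable
  have PB: "1 / 8 \<le> P.prob B"
    unfolding B_def g_eq G_def using P.prob_Gap_ge_min[OF assms(4)] by (simp add: H_def)
  have "ennreal (c' * H) = ennreal (8 * (c' * H)) * ennreal (1 / 8)"
    using cH0 by (simp flip: ennreal_mult)
  also have "\<dots> \<le> ennreal (8 * (c' * H)) * emeasure M B"
    unfolding P.emeasure_eq_measure using PB by (intro mult_left_mono ennreal_leI) auto
  also have "\<dots> = (\<integral>\<^sup>+\<omega>. ennreal (8 * (c' * H)) * indicator B \<omega> \<partial>M)"
    using B by (simp add: nn_integral_cmult_indicator)
  also have "\<dots> \<le> (\<integral>\<^sup>+\<omega>. ennreal (G \<omega>) \<partial>M)"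
    by (rule nn_integral_mono) (auto simp: B_def indicator_def intro: ennreal_leI)
  finally have E: "ennreal (c' * H) \<le> (\<integral>\<^sup>+\<omega>. ennreal (G \<omega>) \<partial>M)" .
  have "P.prob B \<le> P.prob {\<omega> \<in> space M. c' * H \<le> G \<omega>}"
  proof (rule P.finite_measure_mono)
    show "{\<omega> \<in> space M. c' * H \<le> G \<omega>} \<in> P.events" unfolding G_def
      using P.pred_profile[of "\<lambda>x. c' * H \<le> real_of_int (Gap (cycle_vertices n) x)" k] by measurable
    show "B \<subseteq> {\<omega> \<in> space M. c' * H \<le> G \<omega>}" using cH0 by (auto simp: B_def)
  qed
  then have "1 / 8 \<le> P.prob {\<omega> \<in> space M. c' * H \<le> G \<omega>}" using PB by linarith
  with c0 E show ?thesis unfolding G_def H_def by simp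
qed

end
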